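(* Let $(\mathbb{I},J,\omega)$ be the almost-Kähler Iwasawa manifold described in the context. Then $h^{1,0}_{\overline{\partial}}=1$ (spanned by $\varphi^3$), $h^{2,0}_{\overline{\partial}}=1$ (spanned by $i\varphi^1\wedge\varphi^3+\varphi^2\wedge\varphi^3$), and $h^{3,0}_{\overline{\partial}}=1$ (spanned by $\varphi^1\wedge\varphi^2\wedge\varphi^3$).
   Context: General notions. For an almost-complex manifold $(X,J)$, $d=\mu+\partial+\overline{\partial}+\bar\mu$ on $A^{p,q}$ with $\overline{\partial}:A^{p,q}\to A^{p,q+1}$ the $(p,q+1)$-component of $d$. For $X$ compact, $h^{p,0}_{\overline{\partial}}$ denotes the complex dimension of $\{\psi\in A^{p,0}(X):\overline{\partial}\psi=0\}$. The Iwasawa manifold. $\mathbb{H}_3$ is the complex Heisenberg group of matrices $\begin{pmatrix}1&z_1&z_3\\0&1&z_2\\0&0&1\end{pmatrix}$, $z_j=x_j+iy_j\in\mathbb{C}$, $\Gamma\subset\mathbb{H}_3$ the subgroup with $z_1,z_2,z_3\in\mathbb{Z}[i]$, and $\mathbb{I}=\Gamma\backslash\mathbb{H}_3$. Left-invariant real $1$-forms: $e^1=dx_1$, $e^2=dy_1$, $e^3=dx_2$, $e^4=dy_2$, $e^5=dx_3-x_1dx_2+y_1dy_2$, $e^6=dy_3-x_1dy_2-y_1dx_2$, with $de^1=\dots=de^4=0$, $de^5=-e^{13}+e^{24}$, $de^6=-e^{14}-e^{23}$. $J$ is the almost-complex structure whose $(1,0)$-forms are spanned by $\varphi^1=e^1+ie^6$,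 $\varphi^2=e^2+ie^5$, $\varphi^3=e^3+ie^4$, and $\omega=\frac{i}{2}\sum_{j=1}^3\varphi^j\wedge\overline{\varphi^j}$, which is a $J$-compatible symplectic form, so $(\mathbb{I},J,\omega)$ is almost-Kähler. *)

theory Defs
  imports "HOL-Analysis.Analysis"
begin

(* Points of the complex Heisenberg group H_3, via the coordinates (z1,z2,z3)
   of the matrix [[1,z1,z3],[0,1,z2],[0,0,1]].  As a real manifold H_3 = R^6. *)
type_synonym pt = "complex \<times> complex \<times> complex"

(* group law of H_3 (matrix multiplication in these coordinates) *)
definition Hmul :: "pt \<Rightarrow> pt \<Rightarrow> pt" where
  "Hmul a z = (fst a + fst z, fst (snd a) + fst (snd z),
               snd (snd a) + snd (snd z) + fst a * fst (snd z))"

definition gaussian_int :: "complex \<Rightarrow> bool" where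
  "gaussian_int c \<longleftrightarrow> Re c \<in> \<int> \<and> Im c \<in> \<int>"

definition Gamma :: "pt set" where
  "Gamma = {a. gaussian_int (fst a) \<and> gaussian_int (fst (snd a)) \<and> gaussian_int (snd (snd a))}"

coinductive Cinf :: "('a::real_normed_vector \<Rightarrow> 'b::real_normed_vector) \<Rightarrow> bool" where
  "(\<forall>x. f differentiable (at x)) \<Longrightarrow> (\<forall>v. Cinf (\<lambda>x. frechet_derivative f (at x) v)) \<Longrightarrow> Cinf f"

(* complex-valued differential forms on H_3 = R^6: at each point, a function of a
   list of (real) tangent vectors; a k-form is alternating k-multilinear
   on lists of length k and 0 on lists of other lengths *)
type_synonym cform = "pt \<Rightarrow> pt list \<Rightarrow> complex"
type_synonym covec = "pt \<Rightarrow> complex"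

(* wedge product of covectors, convention (a1 ^ ... ^ ak)(v1..vk) = det[a_i(v_j)] *)
definition wedge :: "covec list \<Rightarrow> pt list \<Rightarrow> complex" where
  "wedge as vs = (if length vs = length as then
      (\<Sum>p\<in>{p. p permutes {..<length as}}. of_int (sign p) * (\<Prod>i<length as. (as ! i) (vs ! p i)))
    else 0)"

(* exterior derivative (invariant formula with constant vector fields on R^6) *)
definition ext_d :: "cform \<Rightarrow> cform" where
  "ext_d \<omega> x vs = (\<Sum>i<length vs. (-1) ^ i *
      frechet_derivative (\<lambda>y. \<omega> y (take i vs @ drop (Suc i) vs)) (at x) (vs ! i))"

definition pullback :: "(pt \<Rightarrow> pt) \<Rightarrow> cform \<Rightarrow> cform" where
  "pullback F \<omega> x vs = \<omega> (F x) (map (frechet_derivative F (at x)) vs)"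

(* real coordinates x1,y1,x2,y2,x3,y3 and the left-invariant real coframe e^1..e^6 *)
definition e1 :: "pt \<Rightarrow> covec" where "e1 x v = complex_of_real (Re (fst v))"
definition e2 :: "pt \<Rightarrow> covec" where "e2 x v = complex_of_real (Im (fst v))"
definition e3 :: "pt \<Rightarrow> covec" where "e3 x v = complex_of_real (Re (fst (snd v)))"
definition e4 :: "pt \<Rightarrow> covec" where "e4 x v = complex_of_real (Im (fst (snd v)))"
definition e5 :: "pt \<Rightarrow> covec" where
  "e5 x v = complex_of_real (Re (snd (snd v)) - Re (fst x) * Re (fst (snd v)) + Im (fst x) * Im (fst (snd v)))"
definition e6 :: "pt \<Rightarrow> covec" where
  "e6 x v = complex_of_real (Im (snd (snd v)) - Re (fst x) * Im (fst (snd v)) - Im (fst x) * Re (fst (snd v)))"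

(* the (1,0)-coframe of J: phi^1 = e^1 + i e^6, phi^2 = e^2 + i e^5, phi^3 = e^3 + i e^4 *)
definition phi :: "nat \<Rightarrow> pt \<Rightarrow> covec" where
  "phi j x v = (if j = 1 then e1 x v + \<i> * e6 x v
                else if j = 2 then e2 x v + \<i> * e5 x v
                else e3 x v + \<i> * e4 x v)"

definition phibar :: "nat \<Rightarrow> pt \<Rightarrow> covec" where
  "phibar j x v = cnj (phi j x v)"

definition lin_span_c :: "(pt list \<Rightarrow> complex) set \<Rightarrow> (pt list \<Rightarrow> complex) set" where
  "lin_span_c S = {\<lambda>vs. \<Sum>i<(n::nat). c i * g i vs | n c g. \<forall>i<n. g i \<in> S}"

definition gens :: "nat \<Rightarrow> nat \<Rightarrow> pt \<Rightarrow> (pt list \<Rightarrow> complex) set" where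
  "gens p q x = {wedge (map (\<lambda>j. phi j x) I @ map (\<lambda>j. phibar j x) K) | I K.
      set I \<subseteq> {1,2,3} \<and> set K \<subseteq> {1,2,3} \<and> length I = p \<and> length K = q}"

definition Lam :: "nat \<Rightarrow> nat \<Rightarrow> pt \<Rightarrow> (pt list \<Rightarrow> complex) set" where
  "Lam p q x = lin_span_c (gens p q x)"

(* (r,s)-component of a (r+s)-covector, w.r.t. Lambda^{r+s} = direct sum of Lambda^{a,b} *)
definition bidegree_comp :: "nat \<Rightarrow> nat \<Rightarrow> pt \<Rightarrow> (pt list \<Rightarrow> complex) \<Rightarrow> (pt list \<Rightarrow> complex)" where
  "bidegree_comp r s x \<eta> = (THE \<theta>. \<theta> \<in> Lam r s x \<and>
      (\<lambda>vs. \<eta> vs - \<theta> vs) \<in> lin_span_c (\<Union>{gens a b x | a b. a + b = r + s \<and> (a, b) \<noteq> (r, s)}))"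

definition dbar :: "nat \<Rightarrow> nat \<Rightarrow> cform \<Rightarrow> cform" where
  "dbar p q \<omega> x = bidegree_comp p (Suc q) x (ext_d \<omega> x)"

(* A^{p,q}(I): smooth (p,q)-forms on H_3 invariant under left translation by Gamma,
   i.e. smooth (p,q)-forms on the Iwasawa manifold Gamma\H_3 *)
definition Apq :: "nat \<Rightarrow> nat \<Rightarrow> cform set" where
  "Apq p q = {\<omega>. (\<forall>vs. Cinf (\<lambda>x. \<omega> x vs)) \<and> (\<forall>x. \<omega> x \<in> Lam p q x)
              \<and> (\<forall>\<gamma>\<in>Gamma. pullback (Hmul \<gamma>) \<omega> = \<omega>)}"

(* the space whose complex dimension is h^{p,0}_dbar *)
definition dbar_closed_p0 :: "nat \<Rightarrow> cform set" where
  "dbar_closed_p0 p = {\<psi> \<in> Apq p 0. dbar p 0 \<psi> = (\<lambda>x vs. 0)}"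

definition cline :: "cform \<Rightarrow> cform set" where
  "cline \<psi> = {\<lambda>x vs. c * \<psi> x vs | c. True}"

end

theory Submission
  imports "Jordan_Normal_Form.Determinant" "HOL-Complex_Analysis.Cauchy_Integral_Formula" Defs
begin

text \<open>
  In the coframe \<open>theta 1 = phi 1 - \<i> phi 2\<close>, \<open>theta 2 = phi 1 + \<i> phi 2\<close>, \<open>theta 3 = phi 3\<close>
  the structure equations are \<open>2 dbar (theta 1) = - thetabar 1 \<and> theta 3\<close>,
  \<open>2 dbar (theta 2) = - thetabar 3 \<and> theta 1\<close> and \<open>dbar (theta 3) = 0\<close>. The coefficients of a
  \<open>(p,0)\<close>-form on the quotient are functions on \<open>\<complex>\<^sup>3\<close> invariant under \<open>Gamma\<close>, hence bounded, and
  \<open>dbar \<psi> = 0\<close> is a triangular system for their derivatives along the complex vector fields dual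
  to the \<open>thetabar k\<close>. Through every point each of these fields is the Cauchy-Riemann operator of
  a complex line in \<open>\<complex>\<^sup>3\<close>. A bounded function on the plane whose Cauchy-Riemann derivative is a
  constant is itself constant, since its increments are bounded entire functions. Solving the
  system from the bottom up, each coefficient is therefore constant, and its derivatives vanish,
  which kills all coefficients but the last.
\<close>

section \<open>Exterior multiplication\<close>

definition ext_mult :: "('v \<Rightarrow> complex) \<Rightarrow> ('v list \<Rightarrow> complex) \<Rightarrow> 'v list \<Rightarrow> complex"
    (infixr "\<^bold>\<and>" 75) where
  "(a \<^bold>\<and> \<eta>) vs = (\<Sum>i<length vs. (-1) ^ i * a (vs ! i) * \<eta> (take i vs @ drop (Suc i) vs))"

lemma ext_mult_Nil [simp]: "(a \<^bold>\<and> \<eta>) [] = 0"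
  by (simp add: ext_mult_def)

lemma ext_mult_Cons: "(a \<^bold>\<and> \<eta>) (v # vs) = a v * \<eta> vs - (a \<^bold>\<and> (\<lambda>ws. \<eta> (v # ws))) vs"
  unfolding ext_mult_def
  by (simp add: sum.lessThan_Suc_shift sum_negf del: sum.lessThan_Suc)

lemma ext_mult_zero: "(a \<^bold>\<and> (\<lambda>vs. 0)) vs = 0"
  and ext_mult_add: "(a \<^bold>\<and> (\<lambda>vs. \<eta> vs + \<theta> vs)) vs = (a \<^bold>\<and> \<eta>) vs + (a \<^bold>\<and> \<theta>) vs"
  and ext_mult_diff: "(a \<^bold>\<and> (\<lambda>vs. \<eta> vs - \<theta> vs)) vs = (a \<^bold>\<and> \<eta>) vs - (a \<^bold>\<and> \<theta>) vs"
  and ext_mult_minus: "(a \<^bold>\<and> (\<lambda>vs. - \<eta> vs)) vs = - (a \<^bold>\<and> \<eta>) vs"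
  and ext_mult_scale: "(a \<^bold>\<and> (\<lambda>vs. c * \<eta> vs)) vs = c * (a \<^bold>\<and> \<eta>) vs"
  and ext_mult_divide: "(a \<^bold>\<and> (\<lambda>vs. \<eta> vs / c)) vs = (a \<^bold>\<and> \<eta>) vs / c"
  by (simp_all add: ext_mult_def algebra_simps sum.distrib sum_subtractf sum_negf sum_distrib_left
      sum_divide_distrib)

lemma ext_mult_sum: "(a \<^bold>\<and> (\<lambda>vs. \<Sum>i\<in>I. \<eta> i vs)) vs = (\<Sum>i\<in>I. (a \<^bold>\<and> \<eta> i) vs)"
  by (induction I rule: infinite_finite_induct) (simp_all add: ext_mult_zero ext_mult_add)

lemma covec_zero_ext_mult: "((\<lambda>v. 0) \<^bold>\<and> \<eta>) vs = 0"
  and covec_add_ext_mult: "((\<lambda>v. a v + b v) \<^bold>\<and> \<eta>) vs = (a \<^bold>\<and> \<eta>) vs + (b \<^bold>\<and> \<eta>) vs"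
  and covec_diff_ext_mult: "((\<lambda>v. a v - b v) \<^bold>\<and> \<eta>) vs = (a \<^bold>\<and> \<eta>) vs - (b \<^bold>\<and> \<eta>) vs"
  and covec_scale_ext_mult: "((\<lambda>v. c * a v) \<^bold>\<and> \<eta>) vs = c * (a \<^bold>\<and> \<eta>) vs"
  by (simp_all add: ext_mult_def algebra_simps sum.distrib sum_subtractf sum_distrib_left)

lemma covec_sum_ext_mult: "((\<lambda>v. \<Sum>i\<in>I. a i v) \<^bold>\<and> \<eta>) vs = (\<Sum>i\<in>I. (a i \<^bold>\<and> \<eta>) vs)"
  by (induction I rule: infinite_finite_induct)
     (simp_all add: covec_zero_ext_mult covec_add_ext_mult)

lemmas ext_mult_linear = ext_mult_zero ext_mult_add ext_mult_diff ext_mult_minus ext_mult_scale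
  ext_mult_divide ext_mult_sum covec_zero_ext_mult covec_add_ext_mult covec_diff_ext_mult
  covec_scale_ext_mult covec_sum_ext_mult

text \<open>The product of \<open>\<eta>\<close> with the 2-form \<open>B u v - B v u\<close>.\<close>

fun ext_mult2 :: "('v \<Rightarrow> 'v \<Rightarrow> complex) \<Rightarrow> ('v list \<Rightarrow> complex) \<Rightarrow> 'v list \<Rightarrow> complex" where
  "ext_mult2 B \<eta> [] = 0"
| "ext_mult2 B \<eta> (v # vs) =
     ((\<lambda>w. B v w - B w v) \<^bold>\<and> \<eta>) vs + ext_mult2 B (\<lambda>ws. \<eta> (v # ws)) vs"

lemma ext_mult2_product: "ext_mult2 (\<lambda>u v. a u * b v) \<eta> vs = (a \<^bold>\<and> b \<^bold>\<and> \<eta>) vs"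
proof (induction vs arbitrary: \<eta>)
  case (Cons v vs)
  have "((\<lambda>w. a v * b w - a w * b v) \<^bold>\<and> \<eta>) vs = a v * (b \<^bold>\<and> \<eta>) vs - b v * (a \<^bold>\<and> \<eta>) vs"
    using covec_scale_ext_mult[of "b v" a] by (simp add: ext_mult_linear mult.commute)
  then show ?case
    by (simp add: Cons.IH ext_mult_Cons[abs_def] ext_mult_linear)
qed simp

lemma ext_mult2_scale: "ext_mult2 (\<lambda>u v. c * B u v) \<eta> vs = c * ext_mult2 B \<eta> vs"
  by (induction vs arbitrary: \<eta>)
     (simp_all add: covec_scale_ext_mult distrib_left flip: right_diff_distrib)

lemma ext_mult2_add: "ext_mult2 (\<lambda>u v. B u v + C u v) \<eta> vs = ext_mult2 B \<eta> vs + ext_mult2 C \<eta> vs"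
  by (induction vs arbitrary: \<eta>) (simp_all add: ext_mult_linear)

lemma ext_mult_anticommute: "(a \<^bold>\<and> b \<^bold>\<and> \<eta>) vs = - (b \<^bold>\<and> a \<^bold>\<and> \<eta>) vs"
  by (induction vs arbitrary: \<eta>) (simp_all add: ext_mult_Cons[abs_def] ext_mult_linear)

lemma ext_mult_self: "(a \<^bold>\<and> a \<^bold>\<and> \<eta>) vs = 0"
  using ext_mult_anticommute[of a a \<eta> vs] by simp

section \<open>The wedge product as iterated exterior multiplication\<close>

lemma wedge_Nil: "wedge [] vs = (if vs = [] then 1 else 0)"
  by (simp add: wedge_def)

lemma wedge_eq_det:
  assumes "length vs = length as"
  shows "wedge as vs =
    Determinant.det (Matrix.mat (length as) (length as) (\<lambda>(i, j). (as ! i) (vs ! j)))"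
proof -
  have "wedge as vs = (\<Sum>p | p permutes {0..<length as}.
      of_int (sign p) * (\<Prod>i = 0..<length as. (as ! i) (vs ! p i)))"
    using assms by (simp add: wedge_def lessThan_atLeast0)
  also have "\<dots> = Determinant.det (Matrix.mat (length as) (length as) (\<lambda>(i, j). (as ! i) (vs ! j)))"
    unfolding Determinant.det_def
    by (auto intro!: sum.cong prod.cong simp: permutes_in_image[of _ "{0..<length as}"] sign_def)
  finally show ?thesis .
qed

lemma wedge_Cons_apply:
  assumes "length vs = Suc (length as)"
  shows "wedge (a # as) vs = (a \<^bold>\<and> wedge as) vs"
proof -
  define n where "n = length as"
  define A where "A = Matrix.mat (Suc n) (Suc n) (\<lambda>(i, j). ((a # as) ! i) (vs ! j))"
  have A: "A \<in> carrier_mat (Suc n) (Suc n)" by (simp add: A_def)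
  have minor: "wedge as (take j vs @ drop (Suc j) vs) = Determinant.det (mat_delete A 0 j)"
    if "j < Suc n" for j
  proof -
    have "mat_delete A 0 j =
        Matrix.mat n n (\<lambda>(i, k). (as ! i) ((take j vs @ drop (Suc j) vs) ! k))"
      using that assms
      by (intro eq_matI) (auto simp: mat_delete_def A_def n_def nth_append min_def)
    then show ?thesis using that assms by (subst wedge_eq_det) (auto simp: n_def)
  qed
  have "wedge (a # as) vs = Determinant.det A"
    using assms by (simp add: wedge_eq_det A_def n_def)
  also have "\<dots> = (\<Sum>j<Suc n. A $$ (0, j) * cofactor A 0 j)"
    by (rule laplace_expansion_row[OF A]) simp
  also have "\<dots> = (a \<^bold>\<and> wedge as) vs"
    unfolding ext_mult_def assms n_def[symmetric]
    by (intro sum.cong refl) (simp add: cofactor_def minor, simp add: A_def)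
  finally show ?thesis .
qed

lemma wedge_Cons: "wedge (a # as) = a \<^bold>\<and> wedge as"
proof
  fix vs
  show "wedge (a # as) vs = (a \<^bold>\<and> wedge as) vs"
  proof (cases "length vs = Suc (length as)")
    case False
    then have "wedge as (take i vs @ drop (Suc i) vs) = 0" if "i < length vs" for i
      using that by (auto simp: wedge_def)
    then show ?thesis using False by (simp add: ext_mult_def wedge_def)
  qed (rule wedge_Cons_apply)
qed

lemma ext_mult_wedge_append:
  "(a \<^bold>\<and> wedge (as @ bs)) vs = (-1) ^ length as * wedge (as @ a # bs) vs"
proof (induction as arbitrary: vs)
  case Nil
  show ?case by (simp add: wedge_Cons)
next
  case (Cons b as)
  have "(a \<^bold>\<and> b \<^bold>\<and> wedge (as @ bs)) vs = - (b \<^bold>\<and> a \<^bold>\<and> wedge (as @ bs)) vs"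
    by (rule ext_mult_anticommute)
  also have "\<dots> = - (b \<^bold>\<and> (\<lambda>vs. (-1) ^ length as * wedge (as @ a # bs) vs)) vs"
    by (simp only: Cons.IH[abs_def])
  finally show ?case by (simp add: wedge_Cons ext_mult_linear)
qed

lemma wedge_eq_0_if_annihilated:
  assumes "v \<in> set vs" "\<And>a. a \<in> set as \<Longrightarrow> a v = 0"
  shows "wedge as vs = 0"
proof (cases "length vs = length as")
  case True
  have "(\<Prod>i<length as. (as ! i) (vs ! p i)) = 0" if p: "p permutes {..<length as}" for p
  proof -
    obtain m where "m < length as" "vs ! m = v" using assms(1) True by (metis in_set_conv_nth)
    moreover then obtain i where "i < length as" "p i = m"
      using permutes_image[OF p] by (metis imageE lessThan_iff)
    ultimately show ?thesis using assms(2) by (intro prod_zero) (auto intro!: bexI[of _ i])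
  qed
  then show ?thesis by (auto simp: wedge_def intro!: sum.neutral)
qed (simp add: wedge_def)

lemma wedge_dual:
  fixes f :: "'i::linorder \<Rightarrow> covec" and u :: "'i \<Rightarrow> pt"
  assumes sorted: "sorted I" "distinct I" "sorted K" "distinct K" and "length I = length K"
    and dual: "\<And>i k. i \<in> set I \<Longrightarrow> k \<in> set K \<Longrightarrow> f k (u i) = (if k = i then 1 else 0)"
  shows "wedge (map f K) (map u I) = (if K = I then 1 else 0)"
proof (cases "K = I")
  case True
  have "Matrix.mat (length I) (length I) (\<lambda>(i, j). (map f I ! i) (map u I ! j)) = 1\<^sub>m (length I)"
    by (rule eq_matI) (use dual \<open>distinct I\<close> True in \<open>auto simp: nth_eq_iff_index_eq\<close>)
  then show ?thesis using True by (simp add: wedge_eq_det)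
next
  case False
  then have "set K \<noteq> set I" using sorted sorted_distinct_set_unique by blast
  moreover have "card (set K) = card (set I)" using assms by (simp add: distinct_card)
  ultimately obtain i where "i \<in> set I" "i \<notin> set K"
    by (metis card_subset_eq finite_set subsetI)
  then have "wedge (map f K) (map u I) = 0"
    using dual by (intro wedge_eq_0_if_annihilated[of "u i"]) auto
  then show ?thesis using False by simp
qed

lemma ext_mult_wedge_map_eq_0:
  "j \<in> set I \<Longrightarrow> (f j \<^bold>\<and> wedge (map f I)) vs = 0"
proof (induction I arbitrary: vs)
  case (Cons i I)
  show ?case
  proof (cases "j = i")
    case False
    then have "f j \<^bold>\<and> wedge (map f I) = (\<lambda>vs. 0)" using Cons by auto
    then show ?thesis
      by (simp add: wedge_Cons ext_mult_anticommute[of "f j"] ext_mult_linear)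
  qed (simp add: wedge_Cons ext_mult_self)
qed simp

lemma ext_mult_wedge_map_insort:
  "\<exists>s. \<forall>vs. (f j \<^bold>\<and> wedge (map f I)) vs = s * wedge (map f (insort j I)) vs"
proof (induction I)
  case Nil
  show ?case by (rule exI[of _ 1]) (simp add: wedge_Cons)
next
  case (Cons i I)
  show ?case
  proof (cases "j \<le> i")
    case True
    then show ?thesis by (intro exI[of _ 1]) (simp add: wedge_Cons)
  next
    case False
    obtain s where s: "\<And>vs. (f j \<^bold>\<and> wedge (map f I)) vs = s * wedge (map f (insort j I)) vs"
      using Cons.IH by blast
    have "(f j \<^bold>\<and> f i \<^bold>\<and> wedge (map f I)) vs = - s * wedge (map f (i # insort j I)) vs" for vs
      by (subst ext_mult_anticommute) (simp add: s[abs_def] ext_mult_linear wedge_Cons)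
    then show ?thesis using False by (intro exI[of _ "- s"]) (simp add: wedge_Cons)
  qed
qed

lemma ext_mult_map_scale:
  assumes "\<And>v. a (T v) = c * a v" "\<And>vs. \<eta> (map T vs) = d * \<eta> vs"
  shows "(a \<^bold>\<and> \<eta>) (map T vs) = c * d * (a \<^bold>\<and> \<eta>) vs"
proof -
  have "\<eta> (take i (map T vs) @ drop (Suc i) (map T vs)) = d * \<eta> (take i vs @ drop (Suc i) vs)" for i
    using assms(2)[of "take i vs @ drop (Suc i) vs"] by (simp add: take_map drop_map)
  then show ?thesis
    unfolding ext_mult_def sum_distrib_left using assms(1) by (intro sum.cong) auto
qed

lemma wedge_map_scale:
  assumes "list_all2 (\<lambda>a c. \<forall>v. a (T v) = c * a v) as cs"
  shows "wedge as (map T vs) = prod_list cs * wedge as vs"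
  using assms
proof (induction as cs arbitrary: vs rule: list_all2_induct)
  case (Cons a as c cs)
  then have "(a \<^bold>\<and> wedge as) (map T vs) = c * prod_list cs * (a \<^bold>\<and> wedge as) vs"
    by (intro ext_mult_map_scale) auto
  then show ?case by (simp add: wedge_Cons)
qed (simp add: wedge_Nil)

section \<open>Multilinearity\<close>

definition multilinear :: "('v::real_vector list \<Rightarrow> complex) \<Rightarrow> bool" where
  "multilinear \<eta> \<longleftrightarrow> (\<forall>us ws. linear (\<lambda>v. \<eta> (us @ v # ws)))"

lemma multilinear_ext_mult:
  assumes "linear a" "multilinear \<eta>"
  shows "multilinear (a \<^bold>\<and> \<eta>)"
proof -
  have "linear (\<lambda>v. (a \<^bold>\<and> \<eta>) (us @ v # ws))" for us ws
    using assms(2)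
  proof (induction us arbitrary: \<eta>)
    case Nil
    have "linear (\<lambda>v. \<eta> (v # vs))" for vs
      using Nil[unfolded multilinear_def, rule_format, of "[]" vs] by simp
    then have "linear (\<lambda>v. (a \<^bold>\<and> (\<lambda>vs. \<eta> (v # vs))) ws)"
      unfolding ext_mult_def
      by (intro linear_compose_sum ballI) (auto simp: linear_iff algebra_simps scaleR_conv_of_real)
    then show ?case
      using assms(1) by (auto simp: linear_iff ext_mult_Cons algebra_simps scaleR_conv_of_real)
  next
    case (Cons u us)
    have "multilinear (\<lambda>vs. \<eta> (u # vs))"
      using Cons.prems[unfolded multilinear_def, rule_format, of "u # _"]
      by (simp add: multilinear_def)
    then have "linear (\<lambda>v. (a \<^bold>\<and> (\<lambda>vs. \<eta> (u # vs))) (us @ v # ws))" by (rule Cons.IH)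
    moreover have "linear (\<lambda>v. \<eta> (us @ v # ws))" using Cons.prems by (simp add: multilinear_def)
    ultimately show ?case
      by (auto simp: linear_iff ext_mult_Cons algebra_simps scaleR_conv_of_real)
  qed
  then show ?thesis by (simp add: multilinear_def)
qed

lemma multilinear_wedge: "(\<And>a. a \<in> set as \<Longrightarrow> linear a) \<Longrightarrow> multilinear (wedge as)"
proof (induction as)
  case Nil
  show ?case by (simp add: multilinear_def wedge_Nil linear_iff)
qed (simp add: wedge_Cons multilinear_ext_mult)

lemma multilinear_add_scale:
  "multilinear \<eta> \<Longrightarrow> multilinear \<theta> \<Longrightarrow> multilinear (\<lambda>vs. \<eta> vs + c * \<theta> vs)"
  by (auto simp: multilinear_def linear_iff algebra_simps scaleR_conv_of_real)

lemma differentiable_multilinear_apply: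
  fixes v :: "'k \<Rightarrow> 'a::real_normed_vector \<Rightarrow> 'v::euclidean_space"
  assumes "\<And>x. multilinear (\<eta> x)"
    and "\<And>vs. (\<lambda>x. \<eta> x vs) differentiable (at x)"
    and "\<And>k. k \<in> set I \<Longrightarrow> v k differentiable (at x)"
  shows "(\<lambda>x. \<eta> x (us @ map (\<lambda>k. v k x) I)) differentiable (at x)"
  using assms(3)
proof (induction I arbitrary: us)
  case Nil
  show ?case using assms(2) by simp
next
  case (Cons k I)
  have expand: "\<eta> y (us @ map (\<lambda>k. v k y) (k # I)) =
      (\<Sum>b\<in>Basis. (v k y \<bullet> b) *\<^sub>R \<eta> y ((us @ [b]) @ map (\<lambda>k. v k y) I))" for y
  proof -
    have lin: "linear (\<lambda>w. \<eta> y (us @ w # map (\<lambda>k. v k y) I))"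
      using assms(1) by (simp add: multilinear_def)
    have "\<eta> y (us @ map (\<lambda>k. v k y) (k # I)) =
        \<eta> y (us @ (\<Sum>b\<in>Basis. (v k y \<bullet> b) *\<^sub>R b) # map (\<lambda>k. v k y) I)"
      by (simp add: euclidean_representation)
    also have "\<dots> = (\<Sum>b\<in>Basis. \<eta> y (us @ ((v k y \<bullet> b) *\<^sub>R b) # map (\<lambda>k. v k y) I))"
      by (rule linear_sum[OF lin])
    finally show ?thesis by (simp add: linear_scale[OF lin])
  qed
  have "v k differentiable (at x)" using Cons.prems by simp
  then have "(\<lambda>y. v k y \<bullet> b) differentiable (at x)" for b
    by (rule differentiable_compose[rotated])
       (auto intro: bounded_linear_imp_differentiable bounded_linear_inner_left)
  then show ?case
    unfolding expand
    by (intro differentiable_sum finite_Basis ballI differentiable_scaleR Cons.IH)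
       (use Cons.prems in auto)
qed

section \<open>Spans\<close>

lemma lin_span_cI:
  "(\<And>i. i < n \<Longrightarrow> g i \<in> S) \<Longrightarrow> (\<lambda>vs. \<Sum>i<(n::nat). c i * g i vs) \<in> lin_span_c S"
  unfolding lin_span_c_def by (intro CollectI exI conjI allI impI) auto

lemma lin_span_c_zero: "(\<lambda>vs. 0) \<in> lin_span_c S"
  using lin_span_cI[of 0] by simp

lemma lin_span_c_add_generator:
  assumes "\<eta> \<in> lin_span_c S" "g \<in> S"
  shows "(\<lambda>vs. \<eta> vs + a * g vs) \<in> lin_span_c S"
proof -
  obtain n c h where \<eta>: "\<eta> = (\<lambda>vs. \<Sum>i<(n::nat). c i * h i vs)" and h: "\<forall>i<n. h i \<in> S"
    using assms(1) unfolding lin_span_c_def by blast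
  have "(\<lambda>vs. \<eta> vs + a * g vs) = (\<lambda>vs. \<Sum>i<Suc n. (c(n := a)) i * (h(n := g)) i vs)"
    by (auto simp: \<eta>)
  also have "\<dots> \<in> lin_span_c S"
    using h assms(2) by (intro lin_span_cI) auto
  finally show ?thesis .
qed

lemma lin_span_c_induct [consumes 1, case_names zero add]:
  assumes "\<eta> \<in> lin_span_c S"
    and zero: "P (\<lambda>vs. 0)"
    and add: "\<And>\<eta> a g. \<eta> \<in> lin_span_c S \<Longrightarrow> P \<eta> \<Longrightarrow> g \<in> S \<Longrightarrow> P (\<lambda>vs. \<eta> vs + a * g vs)"
  shows "P \<eta>"
proof -
  obtain n c h where \<eta>: "\<eta> = (\<lambda>vs. \<Sum>i<(n::nat). c i * h i vs)" and h: "\<forall>i<n. h i \<in> S"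
    using assms(1) unfolding lin_span_c_def by blast
  have "P (\<lambda>vs. \<Sum>i<m. c i * h i vs)" if "m \<le> n" for m
    using that
  proof (induction m)
    case (Suc m)
    have "(\<lambda>vs. \<Sum>i<m. c i * h i vs) \<in> lin_span_c S"
      using h Suc.prems by (intro lin_span_cI) auto
    then show ?case using Suc h add[of "\<lambda>vs. \<Sum>i<m. c i * h i vs" "h m" "c m"] by simp
  qed (simp add: zero)
  then show ?thesis by (simp add: \<eta>)
qed

lemma lin_span_c_generator: "g \<in> S \<Longrightarrow> g \<in> lin_span_c S"
  using lin_span_c_add_generator[OF lin_span_c_zero, of g S 1] by simp

lemma lin_span_c_add_scale:
  assumes "\<eta> \<in> lin_span_c S" "\<theta> \<in> lin_span_c S"
  shows "(\<lambda>vs. \<eta> vs + a * \<theta> vs) \<in> lin_span_c S"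
  using assms(2)
proof (induction \<theta> rule: lin_span_c_induct)
  case zero
  show ?case using assms(1) by simp
next
  case (add \<theta> b g)
  then show ?case
    using lin_span_c_add_generator[OF add.IH add.hyps(2), of "a * b"] by (simp add: algebra_simps)
qed

lemma lin_span_c_scale: "\<eta> \<in> lin_span_c S \<Longrightarrow> (\<lambda>vs. a * \<eta> vs) \<in> lin_span_c S"
  using lin_span_c_add_scale[OF lin_span_c_zero] by simp

lemma lin_span_c_add:
  "\<eta> \<in> lin_span_c S \<Longrightarrow> \<theta> \<in> lin_span_c S \<Longrightarrow> (\<lambda>vs. \<eta> vs + \<theta> vs) \<in> lin_span_c S"
  using lin_span_c_add_scale[of \<eta> S \<theta> 1] by simp

lemma lin_span_c_diff:
  "\<eta> \<in> lin_span_c S \<Longrightarrow> \<theta> \<in> lin_span_c S \<Longrightarrow> (\<lambda>vs. \<eta> vs - \<theta> vs) \<in> lin_span_c S"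
  using lin_span_c_add_scale[of \<eta> S \<theta> "-1"] by simp

lemma lin_span_c_sum:
  "(\<And>i. i \<in> I \<Longrightarrow> \<eta> i \<in> lin_span_c S) \<Longrightarrow> (\<lambda>vs. \<Sum>i\<in>I. \<eta> i vs) \<in> lin_span_c S"
  by (induction I rule: infinite_finite_induct) (simp_all add: lin_span_c_zero lin_span_c_add)

lemma lin_span_c_subset:
  assumes "S \<subseteq> lin_span_c T"
  shows "lin_span_c S \<subseteq> lin_span_c T"
proof
  fix \<eta> assume "\<eta> \<in> lin_span_c S"
  then show "\<eta> \<in> lin_span_c T"
    using assms
    by (induction rule: lin_span_c_induct) (auto intro: lin_span_c_zero lin_span_c_add_scale)
qed

lemma lin_span_c_ext_mult:
  assumes "\<eta> \<in> lin_span_c S" "\<And>g. g \<in> S \<Longrightarrow> a \<^bold>\<and> g \<in> lin_span_c T"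
  shows "a \<^bold>\<and> \<eta> \<in> lin_span_c T"
  using assms(1)
proof (induction \<eta> rule: lin_span_c_induct)
  case zero
  show ?case by (simp add: ext_mult_zero[abs_def] lin_span_c_zero)
next
  case (add \<eta> b g)
  then show ?case
    by (simp add: ext_mult_linear[abs_def] lin_span_c_add_scale assms(2))
qed

section \<open>The adapted coframe\<close>

text \<open>With \<open>\<sigma> = dz3 - z1 dz2\<close> the coframe reads \<open>cnj dz1 + \<sigma>\<close>, \<open>dz1 - cnj \<sigma>\<close>, \<open>dz2\<close>;
  unlike that of \<open>phi\<close>, its \<open>dbar\<close> has only two nonzero structure constants.\<close>

definition theta :: "nat \<Rightarrow> pt \<Rightarrow> covec" where
  "theta j x v =
     (if j = 1 then phi 1 x v - \<i> * phi 2 x v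
      else if j = 2 then phi 1 x v + \<i> * phi 2 x v
      else phi 3 x v)"

definition thetabar :: "nat \<Rightarrow> pt \<Rightarrow> covec" where
  "thetabar j x v = cnj (theta j x v)"

lemmas phi_coordinates = phi_def e1_def e2_def e3_def e4_def e5_def e6_def

lemma theta_coordinates:
  "theta j x v =
     (if j = 1 then cnj (fst v) + (snd (snd v) - fst x * fst (snd v))
      else if j = 2 then fst v - cnj (snd (snd v) - fst x * fst (snd v))
      else fst (snd v))"
  by (simp add: theta_def phi_coordinates complex_eq_iff)

lemma phi_eq_theta:
  "phi j x =
     (if j = 1 then (\<lambda>v. 1 / 2 * (theta 1 x v + theta 2 x v))
      else if j = 2 then (\<lambda>v. \<i> / 2 * (theta 1 x v - theta 2 x v))
      else theta 3 x)"
  by (auto simp: theta_def phi_def field_simps)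

definition tangent :: "pt \<Rightarrow> (nat \<Rightarrow> complex) \<Rightarrow> pt" where
  "tangent x w = ((cnj (w 1) + w 2) / 2, w 3, (w 1 - cnj (w 2)) / 2 + fst x * w 3)"

lemma theta_tangent: "j \<in> {1, 2, 3} \<Longrightarrow> theta j x (tangent x w) = w j"
  by (auto simp: theta_coordinates tangent_def field_simps)

lemma tangent_theta: "tangent x (\<lambda>j. theta j x v) = v"
  by (simp add: theta_coordinates tangent_def prod_eq_iff field_simps)

definition frame :: "nat \<Rightarrow> pt \<Rightarrow> complex \<Rightarrow> pt" where
  "frame k x c = tangent x (\<lambda>j. if j = k then c else 0)"

lemma frame_coordinates:
  "frame 1 x c = (cnj c / 2, 0, c / 2)"
  "frame 2 x c = (c / 2, 0, - cnj c / 2)"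
  "frame 3 x c = (0, c, fst x * c)"
  by (simp_all add: frame_def tangent_def)

lemma theta_frame: "j \<in> {1, 2, 3} \<Longrightarrow> theta j x (frame k x c) = (if j = k then c else 0)"
  by (simp add: frame_def theta_tangent)

lemma sum_frame_theta: "(\<Sum>k\<in>{1, 2, 3}. frame k x (theta k x v)) = v"
proof -
  have "(\<Sum>k\<in>{1, 2, 3}. frame k x (theta k x v)) = tangent x (\<lambda>j. theta j x v)"
    by (simp add: frame_coordinates[simplified] tangent_def field_simps)
  then show ?thesis by (simp only: tangent_theta)
qed

lemma bounded_linear_frame: "bounded_linear (frame k x)"
proof -
  have "linear (frame k x)"
    by (rule linearI) (auto simp: frame_def tangent_def algebra_simps scaleR_conv_of_real
        add_divide_distrib complex_eq_iff)
  then show ?thesis by (simp add: linear_conv_bounded_linear)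
qed

lemma linear_phi: "linear (phi j x)"
  by (rule linearI) (auto simp: phi_coordinates algebra_simps scaleR_conv_of_real complex_eq_iff)

section \<open>Bidegrees\<close>

lemma ext_mult_phi_gens:
  assumes "g \<in> gens p q x" "j \<in> {1, 2, 3}"
  shows "phi j x \<^bold>\<and> g \<in> gens (Suc p) q x"
proof -
  obtain I K where g: "g = wedge (map (\<lambda>j. phi j x) I @ map (\<lambda>j. phibar j x) K)"
    and IK: "set I \<subseteq> {1, 2, 3}" "set K \<subseteq> {1, 2, 3}" "length I = p" "length K = q"
    using assms(1) unfolding gens_def by blast
  have "phi j x \<^bold>\<and> g = wedge (map (\<lambda>j. phi j x) (j # I) @ map (\<lambda>j. phibar j x) K)"
    by (simp add: g wedge_Cons)
  moreover have "set (j # I) \<subseteq> {1, 2, 3}" "length (j # I) = Suc p"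
    using IK assms(2) by auto
  ultimately show ?thesis unfolding gens_def using IK by blast
qed

lemma ext_mult_phibar_gens:
  assumes "g \<in> gens p q x" "j \<in> {1, 2, 3}"
  shows "phibar j x \<^bold>\<and> g \<in> lin_span_c (gens p (Suc q) x)"
proof -
  obtain I K where g: "g = wedge (map (\<lambda>j. phi j x) I @ map (\<lambda>j. phibar j x) K)"
    and IK: "set I \<subseteq> {1, 2, 3}" "set K \<subseteq> {1, 2, 3}" "length I = p" "length K = q"
    using assms(1) unfolding gens_def by blast
  have "phibar j x \<^bold>\<and> g = (\<lambda>vs. (-1) ^ p *
      wedge (map (\<lambda>j. phi j x) I @ map (\<lambda>j. phibar j x) (j # K)) vs)"
    using IK by (simp add: g ext_mult_wedge_append[abs_def])
  moreover have "set (j # K) \<subseteq> {1, 2, 3}" "length (j # K) = Suc q"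
    using IK assms(2) by auto
  then have "wedge (map (\<lambda>j. phi j x) I @ map (\<lambda>j. phibar j x) (j # K)) \<in> gens p (Suc q) x"
    unfolding gens_def using IK by blast
  ultimately show ?thesis by (simp add: lin_span_c_scale lin_span_c_generator)
qed

lemma ext_mult_theta_Lam:
  assumes "\<eta> \<in> Lam p q x"
  shows "theta j x \<^bold>\<and> \<eta> \<in> Lam (Suc p) q x"
proof -
  have phi: "phi j x \<^bold>\<and> \<eta> \<in> Lam (Suc p) q x" if "j \<in> {1, 2, 3}" for j
    using assms unfolding Lam_def
    by (rule lin_span_c_ext_mult) (intro lin_span_c_generator ext_mult_phi_gens that)
  have "theta j x \<^bold>\<and> \<eta> =
      (if j = 1 then (\<lambda>vs. (phi 1 x \<^bold>\<and> \<eta>) vs - \<i> * (phi 2 x \<^bold>\<and> \<eta>) vs)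
       else if j = 2 then (\<lambda>vs. (phi 1 x \<^bold>\<and> \<eta>) vs + \<i> * (phi 2 x \<^bold>\<and> \<eta>) vs)
       else phi 3 x \<^bold>\<and> \<eta>)"
    by (auto simp: theta_def[abs_def] ext_mult_linear)
  then show ?thesis
    using phi unfolding Lam_def by (simp add: lin_span_c_add lin_span_c_diff lin_span_c_scale)
qed

lemma ext_mult_thetabar_Lam:
  assumes "\<eta> \<in> Lam p q x"
  shows "thetabar j x \<^bold>\<and> \<eta> \<in> Lam p (Suc q) x"
proof -
  have phibar: "phibar j x \<^bold>\<and> \<eta> \<in> Lam p (Suc q) x" if "j \<in> {1, 2, 3}" for j
    using assms unfolding Lam_def
    by (rule lin_span_c_ext_mult) (rule ext_mult_phibar_gens[OF _ that])
  have "thetabar j x =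
      (if j = 1 then (\<lambda>v. phibar 1 x v + \<i> * phibar 2 x v)
       else if j = 2 then (\<lambda>v. phibar 1 x v - \<i> * phibar 2 x v)
       else phibar 3 x)"
    by (auto simp: thetabar_def theta_def phibar_def)
  then have "thetabar j x \<^bold>\<and> \<eta> =
      (if j = 1 then (\<lambda>vs. (phibar 1 x \<^bold>\<and> \<eta>) vs + \<i> * (phibar 2 x \<^bold>\<and> \<eta>) vs)
       else if j = 2 then (\<lambda>vs. (phibar 1 x \<^bold>\<and> \<eta>) vs - \<i> * (phibar 2 x \<^bold>\<and> \<eta>) vs)
       else phibar 3 x \<^bold>\<and> \<eta>)"
    by (auto simp: ext_mult_linear)
  then show ?thesis
    using phibar unfolding Lam_def by (simp add: lin_span_c_add lin_span_c_diff lin_span_c_scale)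
qed

definition Lam_compl :: "nat \<Rightarrow> nat \<Rightarrow> pt \<Rightarrow> (pt list \<Rightarrow> complex) set" where
  "Lam_compl r s x = lin_span_c (\<Union>{gens a b x | a b. a + b = r + s \<and> (a, b) \<noteq> (r, s)})"

lemma Lam_subset_Lam_compl:
  assumes "a + b = r + s" "a \<noteq> r"
  shows "Lam a b x \<subseteq> Lam_compl r s x"
  unfolding Lam_def Lam_compl_def
  using assms by (intro lin_span_c_subset) (blast intro: lin_span_c_generator)

lemma ext_mult_theta_Lam_compl:
  assumes "\<eta> \<in> Lam_compl r s x"
  shows "theta j x \<^bold>\<and> \<eta> \<in> Lam_compl (Suc r) s x"
  using assms unfolding Lam_compl_def[of r]
proof (induction \<eta> rule: lin_span_c_induct)
  case zero
  show ?case unfolding Lam_compl_def by (simp add: ext_mult_zero[abs_def] lin_span_c_zero)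
next
  case (add \<eta> c g)
  from add.hyps(2) obtain a b where g: "g \<in> gens a b x" "a + b = r + s" "(a, b) \<noteq> (r, s)" by blast
  then have "theta j x \<^bold>\<and> g \<in> Lam (Suc a) b x"
    unfolding Lam_def by (intro ext_mult_theta_Lam[unfolded Lam_def] lin_span_c_generator)
  then have "theta j x \<^bold>\<and> g \<in> Lam_compl (Suc r) s x"
    by (rule subsetD[OF Lam_subset_Lam_compl, rotated 2]) (use g in auto)
  then show ?case
    using add.IH unfolding Lam_compl_def
    by (simp add: ext_mult_linear[abs_def] lin_span_c_add_scale)
qed

definition rotate_tangent :: "pt \<Rightarrow> complex \<Rightarrow> pt \<Rightarrow> pt" where
  "rotate_tangent x \<zeta> v = tangent x (\<lambda>j. \<zeta> * theta j x v)"

lemma phi_rotate_tangent: "phi j x (rotate_tangent x \<zeta> v) = \<zeta> * phi j x v"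
  by (simp add: phi_eq_theta rotate_tangent_def theta_tangent algebra_simps)

lemma gens_rotate_tangent:
  assumes "g \<in> gens a b x" "norm \<zeta> = 1"
  shows "\<zeta> ^ (a + b) * g (map (rotate_tangent x \<zeta>) vs) = (\<zeta>\<^sup>2) ^ a * g vs"
proof -
  obtain I K where g: "g = wedge (map (\<lambda>j. phi j x) I @ map (\<lambda>j. phibar j x) K)"
    and IK: "length I = a" "length K = b"
    using assms(1) unfolding gens_def by blast
  have "list_all2 (\<lambda>\<alpha> c. \<forall>v. \<alpha> (rotate_tangent x \<zeta> v) = c * \<alpha> v)
      (map (\<lambda>j. phi j x) I @ map (\<lambda>j. phibar j x) K) (replicate a \<zeta> @ replicate b (cnj \<zeta>))"
    using IK by (intro list_all2_appendI)
      (simp_all add: list_all2_conv_all_nth phibar_def phi_rotate_tangent)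
  from wedge_map_scale[OF this]
  have "g (map (rotate_tangent x \<zeta>) vs) = \<zeta> ^ a * cnj \<zeta> ^ b * g vs" by (simp add: g)
  moreover have "\<zeta> ^ b * cnj \<zeta> ^ b = 1"
    using assms(2) by (simp flip: power_mult_distrib complex_norm_square)
  ultimately show ?thesis
    by (simp add: power_add power2_eq_square power_mult_distrib ac_simps)
qed

lemma Lam_rotate_tangent:
  assumes "\<eta> \<in> Lam r s x" "norm \<zeta> = 1"
  shows "\<zeta> ^ (r + s) * \<eta> (map (rotate_tangent x \<zeta>) vs) = (\<zeta>\<^sup>2) ^ r * \<eta> vs"
  using assms(1) unfolding Lam_def
proof (induction \<eta> rule: lin_span_c_induct)
  case (add \<eta> c g)
  then show ?case
    using gens_rotate_tangent[OF add.hyps(2) assms(2), of vs] by (simp add: algebra_simps)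
qed simp

lemma Lam_compl_rotate_tangent:
  assumes "\<eta> \<in> Lam_compl r s x"
  shows "\<exists>c. c r = 0 \<and> (\<forall>\<zeta>. norm \<zeta> = 1 \<longrightarrow>
    \<zeta> ^ (r + s) * \<eta> (map (rotate_tangent x \<zeta>) vs) = (\<Sum>a\<le>r + s. c a * (\<zeta>\<^sup>2) ^ a))"
  using assms unfolding Lam_compl_def
proof (induction \<eta> rule: lin_span_c_induct)
  case zero
  show ?case by (intro exI[of _ "\<lambda>a. 0"]) simp
next
  case (add \<eta> d g)
  from add.hyps(2) obtain a b where g: "g \<in> gens a b x" and ab: "a + b = r + s" "(a, b) \<noteq> (r, s)"
    by blast
  obtain c where "c r = 0" and c: "\<And>\<zeta>. norm \<zeta> = 1 \<Longrightarrow>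
      \<zeta> ^ (r + s) * \<eta> (map (rotate_tangent x \<zeta>) vs) = (\<Sum>a\<le>r + s. c a * (\<zeta>\<^sup>2) ^ a)"
    using add.IH by blast
  define c' where "c' i = c i + (if i = a then d * g vs else 0)" for i
  have "c' r = 0" using \<open>c r = 0\<close> ab by (auto simp: c'_def)
  moreover have "\<zeta> ^ (r + s) *
      (\<eta> (map (rotate_tangent x \<zeta>) vs) + d * g (map (rotate_tangent x \<zeta>) vs)) =
      (\<Sum>i\<le>r + s. c' i * (\<zeta>\<^sup>2) ^ i)" if "norm \<zeta> = 1" for \<zeta>
  proof -
    have "(\<Sum>i\<le>r + s. (if i = a then d * g vs else 0) * (\<zeta>\<^sup>2) ^ i) = d * ((\<zeta>\<^sup>2) ^ a * g vs)"
      using ab by (simp add: if_distrib[of "\<lambda>t. t * _"] cong: if_cong)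
    then show ?thesis
      using c[OF that] gens_rotate_tangent[OF g that, of vs]
      by (simp add: c'_def ab algebra_simps sum.distrib)
  qed
  ultimately show ?case by blast
qed

text \<open>Rotating by \<open>\<zeta>\<close> scales bidegree \<open>(a, b)\<close> by \<open>\<zeta> ^ a * cnj \<zeta> ^ b\<close>; comparing coefficients of the
  resulting polynomial in \<open>\<zeta>\<^sup>2\<close> separates the bidegrees.\<close>

lemma Lam_Int_Lam_compl:
  assumes "\<eta> \<in> Lam r s x" "\<eta> \<in> Lam_compl r s x"
  shows "\<eta> = (\<lambda>vs. 0)"
proof
  fix vs
  define n where "n = r + s"
  obtain c where "c r = 0" and c: "\<And>\<zeta>. norm \<zeta> = 1 \<Longrightarrow>
      \<zeta> ^ n * \<eta> (map (rotate_tangent x \<zeta>) vs) = (\<Sum>a\<le>n. c a * (\<zeta>\<^sup>2) ^ a)"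
    using Lam_compl_rotate_tangent[OF assms(2)] unfolding n_def by blast
  define d where "d = c(r := - \<eta> vs)"
  have "(\<Sum>a\<le>n. d a * w ^ a) = 0" if "w ^ Suc n = 1" for w
  proof -
    have "norm w = 1" using power_eq_1_iff[OF that] by simp
    then have "(csqrt w) ^ n * \<eta> (map (rotate_tangent x (csqrt w)) vs) = (\<Sum>a\<le>n. c a * w ^ a)"
      "(csqrt w) ^ n * \<eta> (map (rotate_tangent x (csqrt w)) vs) = w ^ r * \<eta> vs"
      using c[of "csqrt w"] Lam_rotate_tangent[OF assms(1), of "csqrt w" vs]
      by (simp_all add: n_def)
    moreover have "(\<Sum>a\<le>n. d a * w ^ a) = (\<Sum>a\<le>n. c a * w ^ a) - w ^ r * \<eta> vs"
      using \<open>c r = 0\<close> by (simp add: d_def n_def sum.remove[of "{..r + s}" r])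
    ultimately show ?thesis by simp
  qed
  then have roots: "{w. w ^ Suc n = 1} \<subseteq> {w. (\<Sum>a\<le>n. d a * w ^ a) = 0}" by auto
  have "d r = 0"
  proof (rule ccontr)
    assume "d r \<noteq> 0"
    then have "\<exists>a\<le>n. d a \<noteq> 0" by (intro exI[of _ r]) (simp add: n_def)
    from Poly_Roots.polyfun_rootbound[OF this] card_mono[OF _ roots]
    have "card {w :: complex. w ^ Suc n = 1} \<le> n" by simp
    then show False by (simp only: card_roots_unity_eq)
  qed
  then show "\<eta> vs = 0" by (simp add: d_def)
qed

lemma bidegree_comp_eqI:
  assumes "\<theta> \<in> Lam r s x" "(\<lambda>vs. \<eta> vs - \<theta> vs) \<in> Lam_compl r s x"
  shows "bidegree_comp r s x \<eta> = \<theta>"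
  unfolding bidegree_comp_def Lam_compl_def[symmetric]
proof (rule the_equality)
  fix \<theta>' assume \<theta>': "\<theta>' \<in> Lam r s x \<and> (\<lambda>vs. \<eta> vs - \<theta>' vs) \<in> Lam_compl r s x"
  then have "(\<lambda>vs. \<theta>' vs - \<theta> vs) \<in> Lam r s x"
    using assms(1) unfolding Lam_def by (simp add: lin_span_c_diff)
  moreover have "(\<lambda>vs. (\<eta> vs - \<theta> vs) - (\<eta> vs - \<theta>' vs)) \<in> Lam_compl r s x"
    using lin_span_c_diff assms(2) \<theta>'[THEN conjunct2] unfolding Lam_compl_def by blast
  ultimately have "(\<lambda>vs. \<theta>' vs - \<theta> vs) = (\<lambda>vs. 0)"
    by (intro Lam_Int_Lam_compl) (simp_all add: algebra_simps)
  then show "\<theta>' = \<theta>" by (simp add: fun_eq_iff)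
qed (use assms in auto)

section \<open>Forms of type (p,0)\<close>

abbreviation theta_wedge :: "nat list \<Rightarrow> cform" where
  "theta_wedge I x \<equiv> wedge (map (\<lambda>j. theta j x) I)"

abbreviation frame_tuple :: "nat list \<Rightarrow> pt \<Rightarrow> pt list" where
  "frame_tuple I x \<equiv> map (\<lambda>k. frame k x 1) I"

definition multi_indices :: "nat \<Rightarrow> nat list set" where
  "multi_indices p = {I. sorted I \<and> distinct I \<and> set I \<subseteq> {1, 2, 3} \<and> length I = p}"

lemma finite_multi_indices: "finite (multi_indices p)"
proof (rule finite_subset)
  show "multi_indices p \<subseteq> {I. set I \<subseteq> {1, 2, 3} \<and> length I = p}" by (auto simp: multi_indices_def)
qed (rule finite_lists_length_eq, simp)

lemma theta_wedge_frame_tuple: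
  assumes "I \<in> multi_indices p" "J \<in> multi_indices p"
  shows "theta_wedge J x (frame_tuple I x) = (if J = I then 1 else 0)"
  by (rule wedge_dual) (use assms in \<open>auto simp: multi_indices_def theta_frame\<close>)

lemma theta_wedge_Lam: "theta_wedge I x \<in> Lam (length I) 0 x"
proof (induction I)
  case Nil
  have "wedge [] \<in> gens 0 0 x" by (auto simp: gens_def)
  then show ?case by (simp add: Lam_def lin_span_c_generator)
qed (simp add: wedge_Cons ext_mult_theta_Lam)

lemma ext_mult_theta_span_theta_wedge:
  assumes "\<eta> \<in> lin_span_c {theta_wedge I x | I. I \<in> multi_indices p}" "j \<in> {1, 2, 3}"
  shows "theta j x \<^bold>\<and> \<eta> \<in> lin_span_c {theta_wedge I x | I. I \<in> multi_indices (Suc p)}"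
  using assms(1)
proof (rule lin_span_c_ext_mult)
  fix g assume "g \<in> {theta_wedge I x | I. I \<in> multi_indices p}"
  then obtain I where g: "g = theta_wedge I x" and I: "I \<in> multi_indices p" by blast
  show "theta j x \<^bold>\<and> g \<in> lin_span_c {theta_wedge I x | I. I \<in> multi_indices (Suc p)}"
  proof (cases "j \<in> set I")
    case True
    then have "theta j x \<^bold>\<and> g = (\<lambda>vs. 0)"
      using ext_mult_wedge_map_eq_0[of j I "\<lambda>j. theta j x"] by (auto simp: g)
    then show ?thesis by (simp add: lin_span_c_zero)
  next
    case False
    then have "insort j I \<in> multi_indices (Suc p)"
      using I assms(2)
      by (simp add: multi_indices_def sorted_insort distinct_insort set_insort_key)
    moreover obtain s where "theta j x \<^bold>\<and> g = (\<lambda>vs. s * theta_wedge (insort j I) x vs)"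
      using ext_mult_wedge_map_insort[of "\<lambda>j. theta j x" j I] by (auto simp: g)
    ultimately show ?thesis
      by (simp only:) (intro lin_span_c_scale lin_span_c_generator, blast)
  qed
qed

lemma phi_ext_mult:
  "phi j x \<^bold>\<and> \<eta> =
     (if j = 1 then (\<lambda>vs. 1 / 2 * ((theta 1 x \<^bold>\<and> \<eta>) vs + (theta 2 x \<^bold>\<and> \<eta>) vs))
      else if j = 2 then (\<lambda>vs. \<i> / 2 * ((theta 1 x \<^bold>\<and> \<eta>) vs - (theta 2 x \<^bold>\<and> \<eta>) vs))
      else theta 3 x \<^bold>\<and> \<eta>)"
  by (simp only: phi_eq_theta[of j] if_distrib[of "\<lambda>a. a \<^bold>\<and> \<eta>"] ext_mult_linear[abs_def])

lemma Lam_p0_subset_span_theta_wedge: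
  "Lam p 0 x \<subseteq> lin_span_c {theta_wedge I x | I. I \<in> multi_indices p}"
  unfolding Lam_def
proof (rule lin_span_c_subset, rule subsetI)
  fix g assume "g \<in> gens p 0 x"
  then obtain J where g: "g = wedge (map (\<lambda>j. phi j x) J)" and p: "length J = p"
    by (auto simp: gens_def)
  have "wedge (map (\<lambda>j. phi j x) J) \<in>
      lin_span_c {theta_wedge I x | I. I \<in> multi_indices (length J)}"
  proof (induction J)
    case Nil
    have "[] \<in> multi_indices 0" by (simp add: multi_indices_def)
    then show ?case by (intro lin_span_c_generator) (force intro: exI[of _ "[]"])
  next
    case (Cons j J)
    let ?\<eta> = "wedge (map (\<lambda>j. phi j x) J)"
    have "theta k x \<^bold>\<and> ?\<eta> \<in> lin_span_c {theta_wedge I x | I. I \<in> multi_indices (Suc (length J))}"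
      if "k \<in> {1, 2, 3}" for k
      using ext_mult_theta_span_theta_wedge[OF Cons.IH that] .
    then show ?case
      by (simp add: wedge_Cons phi_ext_mult lin_span_c_scale lin_span_c_add lin_span_c_diff
          del: times_divide_eq_left)
  qed
  then show "g \<in> lin_span_c {theta_wedge I x | I. I \<in> multi_indices p}" by (simp add: g p)
qed

lemma Lam_p0_expand:
  assumes "\<eta> \<in> Lam p 0 x"
  shows "\<eta> = (\<lambda>vs. \<Sum>I\<in>multi_indices p. \<eta> (frame_tuple I x) * theta_wedge I x vs)"
proof -
  have "\<eta> \<in> lin_span_c {theta_wedge I x | I. I \<in> multi_indices p}"
    using Lam_p0_subset_span_theta_wedge assms by blast
  then show ?thesis
  proof (induction \<eta> rule: lin_span_c_induct)
    case (add \<eta> c g)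
    then obtain J where g: "g = theta_wedge J x" and J: "J \<in> multi_indices p" by blast
    have "(\<Sum>I\<in>multi_indices p. g (frame_tuple I x) * theta_wedge I x vs) =
        (\<Sum>I\<in>multi_indices p. (if J = I then 1 else 0) * theta_wedge I x vs)" for vs
      unfolding g using J by (intro sum.cong refl) (simp add: theta_wedge_frame_tuple)
    also have "\<dots> vs = g vs" for vs
      using J by (simp add: g finite_multi_indices if_distrib[of "\<lambda>t. t * _"] cong: if_cong)
    finally have "g vs = (\<Sum>I\<in>multi_indices p. g (frame_tuple I x) * theta_wedge I x vs)" for vs
      by simp
    then have "\<eta> vs + c * g vs =
        (\<Sum>I\<in>multi_indices p. \<eta> (frame_tuple I x) * theta_wedge I x vs) +
        c * (\<Sum>I\<in>multi_indices p. g (frame_tuple I x) * theta_wedge I x vs)" for vs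
      by (intro arg_cong2[of _ _ _ _ "\<lambda>s t. s + c * t"] fun_cong[OF add.IH])
    also have "\<dots> vs = (\<Sum>I\<in>multi_indices p.
        (\<eta> (frame_tuple I x) + c * g (frame_tuple I x)) * theta_wedge I x vs)" for vs
      by (simp add: distrib_right sum.distrib sum_distrib_left mult.assoc)
    finally show ?case by (rule ext)
  qed simp
qed

section \<open>Liouville's theorem for the Cauchy-Riemann operator\<close>

definition wirtinger :: "(complex \<Rightarrow> complex) \<Rightarrow> complex" where
  "wirtinger L = (L 1 - \<i> * L \<i>) / 2"

definition wirtinger_bar :: "(complex \<Rightarrow> complex) \<Rightarrow> complex" where
  "wirtinger_bar L = (L 1 + \<i> * L \<i>) / 2"

lemma linear_eq_wirtinger:
  assumes "linear L"
  shows "L c = wirtinger L * c + wirtinger_bar L * cnj c"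
proof -
  have "c = Re c *\<^sub>R 1 + Im c *\<^sub>R \<i>" by (simp add: complex_eq_iff)
  then have "L c = Re c *\<^sub>R L 1 + Im c *\<^sub>R L \<i>"
    by (metis linear_add[OF assms] linear_scale[OF assms])
  also have "\<dots> = wirtinger L * c + wirtinger_bar L * cnj c"
    by (simp add: wirtinger_def wirtinger_bar_def complex_eq_iff algebra_simps add_divide_distrib
        diff_divide_distrib)
  finally show ?thesis .
qed

lemma has_field_derivative_if_wirtinger_bar_eq_0:
  assumes "(f has_derivative L) (at z)" "wirtinger_bar L = 0"
  shows "(f has_field_derivative wirtinger L) (at z)"
proof -
  have "L = (*) (wirtinger L)"
    using linear_eq_wirtinger[OF has_derivative_linear[OF assms(1)]] assms(2) by auto
  then show ?thesis using assms(1) by (simp add: has_field_derivative_def)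
qed

lemma bounded_constant_wirtinger_bar_increment:
  assumes der: "\<And>z. (F has_derivative F' z) (at z)"
    and wirtinger_bar: "\<And>z. wirtinger_bar (F' z) = c"
    and bounded: "bounded (range F)"
  shows "F (w + h) - F w = F h - F 0"
proof -
  let ?G = "\<lambda>w. F (w + h) - F w" and ?G' = "\<lambda>w v. F' (w + h) v - F' w v"
  have "\<exists>D. (?G has_field_derivative D) (at w)" for w
  proof (rule exI, rule has_field_derivative_if_wirtinger_bar_eq_0)
    have "((\<lambda>w. w + h) has_derivative (\<lambda>v. v)) (at w)"
      by (auto intro!: derivative_eq_intros)
    then have "((\<lambda>w. F (w + h)) has_derivative F' (w + h)) (at w)"
      by (rule has_derivative_compose) (rule der)
    then show "(?G has_derivative ?G' w) (at w)" by (intro has_derivative_diff der)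
    have "wirtinger_bar (?G' w) = wirtinger_bar (F' (w + h)) - wirtinger_bar (F' w)"
      by (simp add: wirtinger_bar_def algebra_simps add_divide_distrib diff_divide_distrib)
    then show "wirtinger_bar (?G' w) = 0" by (simp add: wirtinger_bar)
  qed
  then have "?G holomorphic_on UNIV"
    by (simp add: holomorphic_on_open)
  moreover have "bounded (range ?G)"
  proof -
    obtain M where M: "norm (F z) \<le> M" for z using bounded by (auto simp: bounded_iff)
    have "norm (?G w) \<le> M + M" for w using norm_triangle_le_diff[OF add_mono[OF M M]] .
    then show ?thesis by (auto simp: bounded_iff)
  qed
  ultimately have "?G constant_on UNIV" by (rule Liouville_theorem)
  then obtain d where "\<And>w. F (w + h) - F w = d" by (auto simp: constant_on_def)
  from this[of w] this[of 0] show ?thesis by simp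
qed

lemma bounded_constant_wirtinger_bar_imp_constant:
  assumes "\<And>z. (F has_derivative F' z) (at z)" "\<And>z. wirtinger_bar (F' z) = c"
    and bounded: "bounded (range F)"
  shows "F z = F 0"
proof -
  note increment = bounded_constant_wirtinger_bar_increment[OF assms]
  obtain M where M: "norm (F z) \<le> M" for z using bounded by (auto simp: bounded_iff)
  have multiple: "F (of_nat n * z) - F 0 = of_nat n * (F z - F 0)" for n
  proof (induction n)
    case (Suc n)
    have "F (of_nat (Suc n) * z) - F 0 =
        (F (of_nat n * z + z) - F (of_nat n * z)) + (F (of_nat n * z) - F 0)"
      by (simp add: distrib_right add.commute)
    also have "\<dots> = (F z - F 0) + of_nat n * (F z - F 0)" by (simp only: increment Suc.IH)
    finally show ?case by (simp add: algebra_simps)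
  qed simp
  have "real n * norm (F z - F 0) \<le> 2 * M" for n
  proof -
    have "real n * norm (F z - F 0) = norm (F (of_nat n * z) - F 0)"
      by (simp add: multiple norm_mult)
    also have "\<dots> \<le> M + M" using norm_triangle_le_diff[OF add_mono[OF M M]] .
    finally show ?thesis by simp
  qed
  then have "norm (F z - F 0) \<le> 0" using reals_Archimedean3 by (meson not_le)
  then show ?thesis by simp
qed

lemma bounded_constant_wirtinger_bar_eq_0:
  assumes der: "\<And>z. (F has_derivative F' z) (at z)"
    and "\<And>z. wirtinger_bar (F' z) = c" "bounded (range F)"
  shows "c = 0"
proof -
  have "F = (\<lambda>z. F 0)"
    using bounded_constant_wirtinger_bar_imp_constant[OF assms] by blast
  then have "F' 0 = (\<lambda>v. 0)" using der[of 0] by (metis has_derivative_const has_derivative_unique)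
  then show ?thesis using assms(2)[of 0] by (simp add: wirtinger_bar_def)
qed

section \<open>Smooth functions\<close>

lemma frechet_derivative_add:
  assumes "f differentiable (at x)" "g differentiable (at x)"
  shows "frechet_derivative (\<lambda>x. f x + g x) (at x) =
    (\<lambda>v. frechet_derivative f (at x) v + frechet_derivative g (at x) v)"
  using assms by (intro frechet_derivative_at[symmetric] has_derivative_add)
    (simp_all add: frechet_derivative_works)

lemma frechet_derivative_diff:
  assumes "f differentiable (at x)" "g differentiable (at x)"
  shows "frechet_derivative (\<lambda>x. f x - g x) (at x) =
    (\<lambda>v. frechet_derivative f (at x) v - frechet_derivative g (at x) v)"
  using assms by (intro frechet_derivative_at[symmetric] has_derivative_diff)
    (simp_all add: frechet_derivative_works)

lemma frechet_derivative_mult: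
  fixes f g :: "'a::real_normed_vector \<Rightarrow> 'b::real_normed_algebra"
  assumes "f differentiable (at x)" "g differentiable (at x)"
  shows "frechet_derivative (\<lambda>x. f x * g x) (at x) =
    (\<lambda>v. f x * frechet_derivative g (at x) v + frechet_derivative f (at x) v * g x)"
  using assms by (intro frechet_derivative_at[symmetric] has_derivative_mult)
    (simp_all add: frechet_derivative_works)

lemma Cinf_differentiable: "Cinf f \<Longrightarrow> f differentiable (at x)"
  by (erule Cinf.cases) auto

lemma Cinf_frechet_derivative: "Cinf f \<Longrightarrow> Cinf (\<lambda>x. frechet_derivative f (at x) v)"
  by (erule Cinf.cases) auto

text \<open>Derivatives of products are sums of products, so \<open>Cinf\<close> alone is not a coinduction invariant.\<close>

inductive Cinf_closure :: "('a::real_normed_vector \<Rightarrow> complex) \<Rightarrow> bool" where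
  base: "Cinf f \<Longrightarrow> Cinf_closure f"
| const: "Cinf_closure (\<lambda>x. c)"
| linear: "bounded_linear f \<Longrightarrow> Cinf_closure f"
| add: "Cinf_closure f \<Longrightarrow> Cinf_closure g \<Longrightarrow> Cinf_closure (\<lambda>x. f x + g x)"
| mult: "Cinf_closure f \<Longrightarrow> Cinf_closure g \<Longrightarrow> Cinf_closure (\<lambda>x. f x * g x)"

lemma Cinf_closure_derivative:
  assumes "Cinf_closure f"
  shows "(\<forall>x. f differentiable (at x)) \<and> (\<forall>v. Cinf_closure (\<lambda>x. frechet_derivative f (at x) v))"
  using assms
proof induction
  case (base f)
  then show ?case
    by (blast intro: Cinf_closure.base Cinf_differentiable Cinf_frechet_derivative)
next
  case (const c)
  then show ?case by (simp add: Cinf_closure.const)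
next
  case (linear f)
  then have "frechet_derivative f (at x) = f" for x
    by (metis bounded_linear_imp_has_derivative frechet_derivative_at)
  then show ?case using linear by (simp add: bounded_linear_imp_differentiable Cinf_closure.const)
next
  case (add f g)
  then show ?case by (simp add: frechet_derivative_add Cinf_closure.add)
next
  case (mult f g)
  then show ?case by (simp add: frechet_derivative_mult Cinf_closure.add Cinf_closure.mult)
qed

lemma Cinf_closure_imp_Cinf:
  assumes "Cinf_closure f"
  shows "Cinf f"
  using assms
proof (coinduction arbitrary: f rule: Cinf.coinduct)
  case Cinf
  then show ?case using Cinf_closure_derivative[of f] by auto
qed

lemma Cinf_const: "Cinf (\<lambda>x::'a::real_normed_vector. c::complex)"
  by (rule Cinf_closure_imp_Cinf[OF Cinf_closure.const])

lemma Cinf_linear: "bounded_linear f \<Longrightarrow> Cinf (f :: 'a::real_normed_vector \<Rightarrow> complex)"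
  by (rule Cinf_closure_imp_Cinf[OF Cinf_closure.linear])

lemma Cinf_add: "Cinf f \<Longrightarrow> Cinf g \<Longrightarrow> Cinf (\<lambda>x. f x + g x :: complex)"
  by (rule Cinf_closure_imp_Cinf[OF Cinf_closure.add[OF Cinf_closure.base Cinf_closure.base]])

lemma Cinf_mult: "Cinf f \<Longrightarrow> Cinf g \<Longrightarrow> Cinf (\<lambda>x. f x * g x :: complex)"
  by (rule Cinf_closure_imp_Cinf[OF Cinf_closure.mult[OF Cinf_closure.base Cinf_closure.base]])

lemma Cinf_ext_mult:
  assumes "\<And>v. Cinf (\<lambda>x. a x v)" "\<And>vs. Cinf (\<lambda>x. \<eta> x vs)"
  shows "Cinf (\<lambda>x. (a x \<^bold>\<and> \<eta> x) vs)"
  using assms(2)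
proof (induction vs arbitrary: \<eta>)
  case Nil
  show ?case by (simp add: Cinf_const)
next
  case (Cons v vs)
  have "Cinf (\<lambda>x. a x v * \<eta> x vs + (-1) * (a x \<^bold>\<and> (\<lambda>ws. \<eta> x (v # ws))) vs)"
    by (intro Cinf_add Cinf_mult Cinf_const assms(1) Cons)
  then show ?case by (simp add: ext_mult_Cons)
qed

section \<open>The exterior derivative\<close>

lemma ext_d_Nil: "ext_d \<omega> x [] = 0"
  by (simp add: ext_d_def)

lemma ext_d_Cons:
  "ext_d \<omega> x (v # vs) = frechet_derivative (\<lambda>y. \<omega> y vs) (at x) v - ext_d (\<lambda>y ws. \<omega> y (v # ws)) x vs"
  unfolding ext_d_def
  by (simp add: sum.lessThan_Suc_shift sum_negf del: sum.lessThan_Suc)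

lemma ext_d_add:
  assumes "\<And>vs. (\<lambda>y. \<eta> y vs) differentiable (at x)" "\<And>vs. (\<lambda>y. \<theta> y vs) differentiable (at x)"
  shows "ext_d (\<lambda>y vs. \<eta> y vs + \<theta> y vs) x vs = ext_d \<eta> x vs + ext_d \<theta> x vs"
  by (simp add: ext_d_def frechet_derivative_add assms distrib_left sum.distrib)

lemma ext_d_diff:
  assumes "\<And>vs. (\<lambda>y. \<eta> y vs) differentiable (at x)" "\<And>vs. (\<lambda>y. \<theta> y vs) differentiable (at x)"
  shows "ext_d (\<lambda>y vs. \<eta> y vs - \<theta> y vs) x vs = ext_d \<eta> x vs - ext_d \<theta> x vs"
  by (simp add: ext_d_def frechet_derivative_diff assms right_diff_distrib sum_subtractf)

lemma ext_d_mult: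
  assumes "f differentiable (at x)" "\<And>vs. (\<lambda>y. \<eta> y vs) differentiable (at x)"
  shows "ext_d (\<lambda>y vs. f y * \<eta> y vs) x vs =
    (frechet_derivative f (at x) \<^bold>\<and> \<eta> x) vs + f x * ext_d \<eta> x vs"
  by (simp add: ext_d_def ext_mult_def frechet_derivative_mult assms distrib_left sum.distrib
      sum_distrib_left ac_simps)

lemma has_derivative_ext_mult:
  assumes "\<And>v. ((\<lambda>y. a y v) has_derivative (\<lambda>u. a' u v)) (at x)"
    and "\<And>vs. ((\<lambda>y. \<eta> y vs) has_derivative (\<lambda>u. \<eta>' u vs)) (at x)"
  shows "((\<lambda>y. (a y \<^bold>\<and> \<eta> y) vs) has_derivative
    (\<lambda>u. (a' u \<^bold>\<and> \<eta> x) vs + (a x \<^bold>\<and> \<eta>' u) vs)) (at x)"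
  using assms(2)
proof (induction vs arbitrary: \<eta> \<eta>')
  case (Cons v vs)
  show ?case
    unfolding ext_mult_Cons
    by (rule has_derivative_eq_rhs[OF has_derivative_diff[OF
            has_derivative_mult[OF assms(1) Cons.prems] Cons.IH[OF Cons.prems]]])
       (simp add: algebra_simps)
qed simp

lemma differentiable_ext_mult:
  assumes "\<And>v. (\<lambda>y. a y v) differentiable (at x)" "\<And>vs. (\<lambda>y. \<eta> y vs) differentiable (at x)"
  shows "(\<lambda>y. (a y \<^bold>\<and> \<eta> y) vs) differentiable (at x)"
  unfolding ext_mult_def
  by (intro differentiable_sum finite_lessThan ballI differentiable_mult differentiable_const assms)

lemma ext_d_ext_mult_fix_first:
  fixes a :: "pt \<Rightarrow> covec" and \<eta> :: cform
  assumes a: "\<And>v. ((\<lambda>y. a y v) has_derivative (\<lambda>u. a' u v)) (at x)"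
    and \<eta>: "\<And>vs. (\<lambda>y. \<eta> y vs) differentiable (at x)"
  shows "ext_d (\<lambda>y ws. (a y \<^bold>\<and> \<eta> y) (v # ws)) x vs =
    ((\<lambda>u. a' u v) \<^bold>\<and> \<eta> x) vs + a x v * ext_d \<eta> x vs
    - ext_d (\<lambda>y. a y \<^bold>\<and> (\<lambda>ws. \<eta> y (v # ws))) x vs"
proof -
  have a_diff: "(\<lambda>y. a y v) differentiable (at x)" for v
    using a[of v] unfolding differentiable_def by blast
  have "(\<lambda>y. (a y \<^bold>\<and> (\<lambda>ws. \<eta> y (v # ws))) ws) differentiable (at x)" for ws
    by (intro differentiable_ext_mult a_diff \<eta>)
  moreover have "(\<lambda>y. a y v * \<eta> y ws) differentiable (at x)" for ws
    by (intro differentiable_mult a_diff \<eta>)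
  ultimately have "ext_d (\<lambda>y ws. (a y \<^bold>\<and> \<eta> y) (v # ws)) x vs =
      ext_d (\<lambda>y ws. a y v * \<eta> y ws) x vs - ext_d (\<lambda>y. a y \<^bold>\<and> (\<lambda>ws. \<eta> y (v # ws))) x vs"
    by (simp add: ext_mult_Cons ext_d_diff)
  also have "ext_d (\<lambda>y ws. a y v * \<eta> y ws) x vs =
      ((\<lambda>u. a' u v) \<^bold>\<and> \<eta> x) vs + a x v * ext_d \<eta> x vs"
    using frechet_derivative_at[OF a, of v] by (simp add: ext_d_mult a_diff \<eta>)
  finally show ?thesis .
qed

text \<open>\<open>a' u v - a' v u\<close> is the exterior derivative of the covector field \<open>a\<close>.\<close>

lemma ext_d_ext_mult:
  fixes a :: "pt \<Rightarrow> covec" and \<eta> :: cform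
  assumes a: "\<And>v. ((\<lambda>y. a y v) has_derivative (\<lambda>u. a' u v)) (at x)"
    and \<eta>: "\<And>vs. (\<lambda>y. \<eta> y vs) differentiable (at x)"
  shows "ext_d (\<lambda>y. a y \<^bold>\<and> \<eta> y) x vs = ext_mult2 a' (\<eta> x) vs - (a x \<^bold>\<and> ext_d \<eta> x) vs"
  using \<eta>
proof (induction vs arbitrary: \<eta>)
  case Nil
  show ?case by (simp add: ext_d_Nil)
next
  case (Cons v vs)
  have \<eta>': "((\<lambda>y. \<eta> y vs) has_derivative
      (\<lambda>u. frechet_derivative (\<lambda>y. \<eta> y vs) (at x) u)) (at x)" for vs
    using Cons.prems by (simp add: frechet_derivative_works)
  have "frechet_derivative (\<lambda>y. (a y \<^bold>\<and> \<eta> y) vs) (at x) v =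
      (a' v \<^bold>\<and> \<eta> x) vs + (a x \<^bold>\<and> (\<lambda>ws. frechet_derivative (\<lambda>y. \<eta> y ws) (at x) v)) vs"
    by (simp add: frechet_derivative_at[OF has_derivative_ext_mult[OF a \<eta>'], symmetric])
  moreover have "ext_d (\<lambda>y. a y \<^bold>\<and> (\<lambda>ws. \<eta> y (v # ws))) x vs =
      ext_mult2 a' (\<lambda>ws. \<eta> x (v # ws)) vs - (a x \<^bold>\<and> ext_d (\<lambda>y ws. \<eta> y (v # ws)) x) vs"
    by (rule Cons.IH[OF Cons.prems])
  ultimately show ?case
    unfolding ext_d_Cons[of "\<lambda>y. a y \<^bold>\<and> \<eta> y"] ext_d_ext_mult_fix_first[OF a Cons.prems]
    by (simp add: ext_mult_Cons ext_d_Cons[abs_def] ext_mult_linear)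
qed

section \<open>The operator dbar on forms of type (p,0)\<close>

definition del_frame :: "nat \<Rightarrow> (pt \<Rightarrow> complex) \<Rightarrow> pt \<Rightarrow> complex" where
  "del_frame k f x = wirtinger (\<lambda>c. frechet_derivative f (at x) (frame k x c))"

definition delbar_frame :: "nat \<Rightarrow> (pt \<Rightarrow> complex) \<Rightarrow> pt \<Rightarrow> complex" where
  "delbar_frame k f x = wirtinger_bar (\<lambda>c. frechet_derivative f (at x) (frame k x c))"

lemma frechet_derivative_eq_frame:
  assumes "f differentiable (at x)"
  shows "frechet_derivative f (at x) v =
    (\<Sum>k\<in>{1, 2, 3}. del_frame k f x * theta k x v + delbar_frame k f x * thetabar k x v)"
proof -
  let ?D = "frechet_derivative f (at x)"
  have D: "linear ?D" using assms by (rule linear_frechet_derivative)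
  have "linear (\<lambda>c. ?D (frame k x c))" for k
    using linear_compose[OF bounded_linear.linear[OF bounded_linear_frame] D] by (simp add: o_def)
  then have along_frame:
    "?D (frame k x c) = del_frame k f x * c + delbar_frame k f x * cnj c" for k c
    unfolding del_frame_def delbar_frame_def by (rule linear_eq_wirtinger)
  have "?D v = ?D (\<Sum>k\<in>{1, 2, 3}. frame k x (theta k x v))" by (simp only: sum_frame_theta)
  also have "\<dots> = (\<Sum>k\<in>{1, 2, 3}. ?D (frame k x (theta k x v)))" by (rule linear_sum[OF D])
  finally show ?thesis by (simp only: along_frame thetabar_def)
qed

definition dtheta :: "nat \<Rightarrow> pt \<Rightarrow> pt \<Rightarrow> complex" where
  "dtheta j u v =
     (if j = 1 then - (fst u * fst (snd v)) else if j = 2 then cnj (fst u * fst (snd v)) else 0)"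

lemma theta_has_derivative: "((\<lambda>x. theta j x v) has_derivative (\<lambda>u. dtheta j u v)) (at x)"
  unfolding theta_coordinates dtheta_def
  by (cases "j = 1"; cases "j = 2") (auto intro!: derivative_eq_intros)

lemma theta_differentiable: "(\<lambda>x. theta j x v) differentiable (at x)"
  using theta_has_derivative[of j v x] unfolding differentiable_def by blast

lemma dtheta_eq:
  "dtheta j =
     (if j = 1 then
        (\<lambda>u v. (- 1 / 2) * (thetabar 1 x u * theta 3 x v) + (- 1 / 2) * (theta 2 x u * theta 3 x v))
      else if j = 2 then
        (\<lambda>u v. 1 / 2 * (theta 1 x u * thetabar 3 x v) + 1 / 2 * (thetabar 2 x u * thetabar 3 x v))
      else (\<lambda>u v. 0))"
  by (auto simp: dtheta_def theta_coordinates thetabar_def fun_eq_iff field_simps)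

text \<open>The structure equations: \<open>dbar (theta j)\<close> is the sum of the \<open>thetabar k \<and> dbar_theta k j\<close>.\<close>

definition dbar_theta :: "nat \<Rightarrow> nat \<Rightarrow> pt \<Rightarrow> covec" where
  "dbar_theta k j x =
     (if j = 1 \<and> k = 1 then (\<lambda>v. (- 1 / 2) * theta 3 x v)
      else if j = 2 \<and> k = 3 then (\<lambda>v. (- 1 / 2) * theta 1 x v)
      else (\<lambda>v. 0))"

lemma dbar_theta_ext_mult:
  "dbar_theta k j x \<^bold>\<and> \<eta> =
     (if j = 1 \<and> k = 1 then (\<lambda>vs. (- 1 / 2) * (theta 3 x \<^bold>\<and> \<eta>) vs)
      else if j = 2 \<and> k = 3 then (\<lambda>vs. (- 1 / 2) * (theta 1 x \<^bold>\<and> \<eta>) vs)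
      else (\<lambda>vs. 0))"
  by (simp only: dbar_theta_def if_distrib[of "\<lambda>a. a \<^bold>\<and> \<eta>"] ext_mult_linear[abs_def])

lemma dbar_theta_ext_mult_Lam:
  assumes "\<eta> \<in> Lam p q x"
  shows "dbar_theta k j x \<^bold>\<and> \<eta> \<in> Lam (Suc p) q x"
  using ext_mult_theta_Lam[OF assms] unfolding dbar_theta_ext_mult Lam_def
  by (simp only: lin_span_c_scale lin_span_c_zero split: if_split) simp

lemma ext_mult2_dtheta:
  "ext_mult2 (dtheta j) \<eta> =
     (if j = 1 then
        (\<lambda>vs. (- 1 / 2) * (thetabar 1 x \<^bold>\<and> theta 3 x \<^bold>\<and> \<eta>) vs +
              (- 1 / 2) * (theta 2 x \<^bold>\<and> theta 3 x \<^bold>\<and> \<eta>) vs)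
      else if j = 2 then
        (\<lambda>vs. 1 / 2 * (theta 1 x \<^bold>\<and> thetabar 3 x \<^bold>\<and> \<eta>) vs +
              1 / 2 * (thetabar 2 x \<^bold>\<and> thetabar 3 x \<^bold>\<and> \<eta>) vs)
      else (\<lambda>vs. 0))"
proof -
  have "ext_mult2 (\<lambda>u v. 0) \<eta> = (\<lambda>vs. 0)"
    using ext_mult2_scale[of 0 "\<lambda>u v. 0" \<eta>] by auto
  then show ?thesis
    by (simp only: dtheta_eq[of j x] if_distrib[of "\<lambda>B. ext_mult2 B \<eta>"] ext_mult2_add[abs_def]
        ext_mult2_scale[abs_def] ext_mult2_product[abs_def])
qed

lemma ext_mult2_dtheta_Lam_compl:
  assumes "\<eta> \<in> Lam p 0 x"
  shows "(\<lambda>vs. ext_mult2 (dtheta j) \<eta> vs -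
    (\<Sum>k\<in>{1, 2, 3}. (thetabar k x \<^bold>\<and> dbar_theta k j x \<^bold>\<and> \<eta>) vs)) \<in> Lam_compl (Suc p) 1 x"
proof -
  have theta_theta: "theta i x \<^bold>\<and> theta k x \<^bold>\<and> \<eta> \<in> Lam_compl (Suc p) 1 x" for i k
    by (rule subsetD[OF Lam_subset_Lam_compl[of "Suc (Suc p)" 0]])
       (simp_all add: ext_mult_theta_Lam assms)
  have thetabar_thetabar: "thetabar i x \<^bold>\<and> thetabar k x \<^bold>\<and> \<eta> \<in> Lam_compl (Suc p) 1 x" for i k
    by (rule subsetD[OF Lam_subset_Lam_compl[of p "Suc (Suc 0)"]])
       (simp_all add: ext_mult_thetabar_Lam assms)
  have "(\<lambda>vs. ext_mult2 (dtheta j) \<eta> vs -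
        (\<Sum>k\<in>{1, 2, 3}. (thetabar k x \<^bold>\<and> dbar_theta k j x \<^bold>\<and> \<eta>) vs)) =
      (if j = 1 then (\<lambda>vs. (- 1 / 2) * (theta 2 x \<^bold>\<and> theta 3 x \<^bold>\<and> \<eta>) vs)
       else if j = 2 then (\<lambda>vs. 1 / 2 * (thetabar 2 x \<^bold>\<and> thetabar 3 x \<^bold>\<and> \<eta>) vs)
       else (\<lambda>vs. 0))"
    unfolding ext_mult2_dtheta[of j \<eta> x] dbar_theta_ext_mult
    by (auto simp: ext_mult_linear ext_mult_anticommute[of "theta i x" "thetabar k x" for i k]
        simp del: times_divide_eq_left)
  then show ?thesis
    using theta_theta thetabar_thetabar unfolding Lam_compl_def
    by (simp only: lin_span_c_scale lin_span_c_zero split: if_split) simp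
qed

text \<open>The forms \<open>\<xi> k\<close> are the coefficients of \<open>dbar \<omega>\<close> along the \<open>thetabar k\<close>. With \<open>thetabar k\<close>
  as the first factor, each \<open>\<omega> \<mapsto> \<xi> k\<close> is a derivation without signs.\<close>

definition has_dbar :: "nat \<Rightarrow> cform \<Rightarrow> pt \<Rightarrow> (nat \<Rightarrow> pt list \<Rightarrow> complex) \<Rightarrow> bool" where
  "has_dbar p \<omega> x \<xi> \<longleftrightarrow>
     (\<forall>vs. (\<lambda>y. \<omega> y vs) differentiable (at x)) \<and> \<omega> x \<in> Lam p 0 x \<and> (\<forall>k. \<xi> k \<in> Lam p 0 x) \<and>
     (\<lambda>vs. ext_d \<omega> x vs - (\<Sum>k\<in>{1, 2, 3}. (thetabar k x \<^bold>\<and> \<xi> k) vs)) \<in> Lam_compl p 1 x"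

lemma has_dbarD:
  assumes "has_dbar p \<omega> x \<xi>"
  shows "(\<lambda>y. \<omega> y vs) differentiable (at x)" "\<omega> x \<in> Lam p 0 x" "\<xi> k \<in> Lam p 0 x"
    "(\<lambda>vs. ext_d \<omega> x vs - (\<Sum>k\<in>{1, 2, 3}. (thetabar k x \<^bold>\<and> \<xi> k) vs)) \<in> Lam_compl p 1 x"
  using assms by (auto simp: has_dbar_def)

lemma has_dbar_imp_dbar_eq:
  assumes "has_dbar p \<omega> x \<xi>"
  shows "dbar p 0 \<omega> x = (\<lambda>vs. \<Sum>k\<in>{1, 2, 3}. (thetabar k x \<^bold>\<and> \<xi> k) vs)"
proof -
  have "(\<lambda>vs. \<Sum>k\<in>{1, 2, 3}. (thetabar k x \<^bold>\<and> \<xi> k) vs) \<in> Lam p 1 x"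
    using ext_mult_thetabar_Lam[OF has_dbarD(3)[OF assms]]
    unfolding Lam_def One_nat_def by (intro lin_span_c_sum)
  then show ?thesis
    using has_dbarD(4)[OF assms] by (simp add: dbar_def bidegree_comp_eqI del: sum.insert)
qed

lemma has_dbar_zero: "has_dbar p (\<lambda>y vs. 0) x (\<lambda>k vs. 0)"
  by (simp add: has_dbar_def ext_d_def ext_mult_zero Lam_def Lam_compl_def lin_span_c_zero)

lemma has_dbar_add:
  assumes "has_dbar p \<eta> x \<xi>" "has_dbar p \<theta> x \<zeta>"
  shows "has_dbar p (\<lambda>y vs. \<eta> y vs + \<theta> y vs) x (\<lambda>k vs. \<xi> k vs + \<zeta> k vs)"
  unfolding has_dbar_def
proof (intro conjI allI)
  note \<eta> = has_dbarD[OF assms(1)] and \<theta> = has_dbarD[OF assms(2)]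
  show "(\<lambda>y. \<eta> y vs + \<theta> y vs) differentiable (at x)" for vs
    by (intro differentiable_add \<eta> \<theta>)
  show "(\<lambda>vs. \<eta> x vs + \<theta> x vs) \<in> Lam p 0 x" "(\<lambda>vs. \<xi> k vs + \<zeta> k vs) \<in> Lam p 0 x" for k
    using \<eta>(2,3) \<theta>(2,3) unfolding Lam_def by (simp_all add: lin_span_c_add)
  have "ext_d (\<lambda>y vs. \<eta> y vs + \<theta> y vs) x vs -
        (\<Sum>k\<in>{1, 2, 3}. (thetabar k x \<^bold>\<and> (\<lambda>vs. \<xi> k vs + \<zeta> k vs)) vs) =
      (ext_d \<eta> x vs - (\<Sum>k\<in>{1, 2, 3}. (thetabar k x \<^bold>\<and> \<xi> k) vs)) +
      (ext_d \<theta> x vs - (\<Sum>k\<in>{1, 2, 3}. (thetabar k x \<^bold>\<and> \<zeta> k) vs))" for vs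
    by (simp add: ext_d_add \<eta>(1) \<theta>(1) ext_mult_add)
  then show "(\<lambda>vs. ext_d (\<lambda>y vs. \<eta> y vs + \<theta> y vs) x vs -
      (\<Sum>k\<in>{1, 2, 3}. (thetabar k x \<^bold>\<and> (\<lambda>vs. \<xi> k vs + \<zeta> k vs)) vs)) \<in> Lam_compl p 1 x"
    using \<eta>(4) \<theta>(4) unfolding Lam_compl_def by (simp only: lin_span_c_add)
qed

lemma has_dbar_sum:
  assumes "\<And>i. i \<in> I \<Longrightarrow> has_dbar p (\<eta> i) x (\<xi> i)"
  shows "has_dbar p (\<lambda>y vs. \<Sum>i\<in>I. \<eta> i y vs) x (\<lambda>k vs. \<Sum>i\<in>I. \<xi> i k vs)"
  using assms
  by (induction I rule: infinite_finite_induct) (simp_all add: has_dbar_zero has_dbar_add)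

lemma has_dbar_mult:
  assumes "f differentiable (at x)" "has_dbar p \<eta> x \<xi>"
  shows "has_dbar p (\<lambda>y vs. f y * \<eta> y vs) x (\<lambda>k vs. delbar_frame k f x * \<eta> x vs + f x * \<xi> k vs)"
  unfolding has_dbar_def
proof (intro conjI allI)
  note \<eta> = has_dbarD[OF assms(2)]
  show "(\<lambda>y. f y * \<eta> y vs) differentiable (at x)" for vs
    by (intro differentiable_mult assms \<eta>)
  show "(\<lambda>vs. f x * \<eta> x vs) \<in> Lam p 0 x"
    "(\<lambda>vs. delbar_frame k f x * \<eta> x vs + f x * \<xi> k vs) \<in> Lam p 0 x" for k
    using \<eta>(2,3) unfolding Lam_def by (simp_all add: lin_span_c_add lin_span_c_scale)
  have "theta k x \<^bold>\<and> \<eta> x \<in> Lam_compl p 1 x" for k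
    by (rule subsetD[OF Lam_subset_Lam_compl[of "Suc p" 0]]) (simp_all add: ext_mult_theta_Lam \<eta>(2))
  then have "(\<lambda>vs. (\<Sum>k\<in>{1, 2, 3}. del_frame k f x * (theta k x \<^bold>\<and> \<eta> x) vs) +
      f x * (ext_d \<eta> x vs - (\<Sum>k\<in>{1, 2, 3}. (thetabar k x \<^bold>\<and> \<xi> k) vs))) \<in> Lam_compl p 1 x"
    using \<eta>(4) unfolding Lam_compl_def
    by (intro lin_span_c_add lin_span_c_sum lin_span_c_scale)
  moreover have "ext_d (\<lambda>y vs. f y * \<eta> y vs) x vs -
        (\<Sum>k\<in>{1, 2, 3}. (thetabar k x \<^bold>\<and> (\<lambda>vs. delbar_frame k f x * \<eta> x vs + f x * \<xi> k vs)) vs) =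
      (\<Sum>k\<in>{1, 2, 3}. del_frame k f x * (theta k x \<^bold>\<and> \<eta> x) vs) +
      f x * (ext_d \<eta> x vs - (\<Sum>k\<in>{1, 2, 3}. (thetabar k x \<^bold>\<and> \<xi> k) vs))" for vs
    by (simp only: ext_d_mult[OF assms(1) \<eta>(1)] frechet_derivative_eq_frame[OF assms(1), abs_def]
        ext_mult_linear) (simp add: algebra_simps)
  ultimately show "(\<lambda>vs. ext_d (\<lambda>y vs. f y * \<eta> y vs) x vs -
      (\<Sum>k\<in>{1, 2, 3}. (thetabar k x \<^bold>\<and>
        (\<lambda>vs. delbar_frame k f x * \<eta> x vs + f x * \<xi> k vs)) vs)) \<in> Lam_compl p 1 x"
    by (simp only:)
qed

lemma has_dbar_ext_mult_theta:
  assumes "has_dbar p \<eta> x \<xi>"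
  shows "has_dbar (Suc p) (\<lambda>y. theta j y \<^bold>\<and> \<eta> y) x
    (\<lambda>k vs. (dbar_theta k j x \<^bold>\<and> \<eta> x) vs + (theta j x \<^bold>\<and> \<xi> k) vs)"
  unfolding has_dbar_def
proof (intro conjI allI)
  note \<eta> = has_dbarD[OF assms]
  show "(\<lambda>y. (theta j y \<^bold>\<and> \<eta> y) vs) differentiable (at x)" for vs
    by (intro differentiable_ext_mult theta_differentiable \<eta>)
  show "theta j x \<^bold>\<and> \<eta> x \<in> Lam (Suc p) 0 x"
    by (intro ext_mult_theta_Lam \<eta>)
  show "(\<lambda>vs. (dbar_theta k j x \<^bold>\<and> \<eta> x) vs + (theta j x \<^bold>\<and> \<xi> k) vs) \<in> Lam (Suc p) 0 x" for k
    using dbar_theta_ext_mult_Lam[OF \<eta>(2)] ext_mult_theta_Lam[OF \<eta>(3)] unfolding Lam_def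
    by (rule lin_span_c_add)
  have "(\<lambda>vs. (ext_mult2 (dtheta j) (\<eta> x) vs -
        (\<Sum>k\<in>{1, 2, 3}. (thetabar k x \<^bold>\<and> dbar_theta k j x \<^bold>\<and> \<eta> x) vs)) -
      (theta j x \<^bold>\<and> (\<lambda>vs. ext_d \<eta> x vs - (\<Sum>k\<in>{1, 2, 3}. (thetabar k x \<^bold>\<and> \<xi> k) vs))) vs)
      \<in> Lam_compl (Suc p) 1 x"
    using ext_mult2_dtheta_Lam_compl[OF \<eta>(2)] ext_mult_theta_Lam_compl[OF \<eta>(4)]
    unfolding Lam_compl_def by (rule lin_span_c_diff)
  then show "(\<lambda>vs. ext_d (\<lambda>y. theta j y \<^bold>\<and> \<eta> y) x vs -
      (\<Sum>k\<in>{1, 2, 3}. (thetabar k x \<^bold>\<and>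
        (\<lambda>vs. (dbar_theta k j x \<^bold>\<and> \<eta> x) vs + (theta j x \<^bold>\<and> \<xi> k) vs)) vs)) \<in> Lam_compl (Suc p) 1 x"
    by (simp add: ext_d_ext_mult[OF theta_has_derivative \<eta>(1)] ext_mult_linear
        ext_mult_anticommute[of "theta j x" "thetabar _ x"] algebra_simps)
qed

primrec dbar_theta_wedge :: "nat \<Rightarrow> nat list \<Rightarrow> pt \<Rightarrow> pt list \<Rightarrow> complex" where
  "dbar_theta_wedge k [] x = (\<lambda>vs. 0)"
| "dbar_theta_wedge k (j # I) x =
     (\<lambda>vs. (dbar_theta k j x \<^bold>\<and> theta_wedge I x) vs + (theta j x \<^bold>\<and> dbar_theta_wedge k I x) vs)"

lemma has_dbar_theta_wedge: "has_dbar (length I) (theta_wedge I) x (\<lambda>k. dbar_theta_wedge k I x)"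
proof (induction I)
  case Nil
  have "ext_d (\<lambda>y. wedge []) x vs = 0" for vs by (simp add: ext_d_def)
  then show ?case
    using theta_wedge_Lam[of x "[]"]
    by (simp add: has_dbar_def ext_mult_zero Lam_def Lam_compl_def lin_span_c_zero)
next
  case (Cons j I)
  show ?case using has_dbar_ext_mult_theta[OF Cons.IH, of j] by (simp add: wedge_Cons)
qed

definition contract_bar :: "nat \<Rightarrow> pt \<Rightarrow> (pt list \<Rightarrow> complex) \<Rightarrow> pt list \<Rightarrow> complex" where
  "contract_bar k x \<eta> vs = wirtinger_bar (\<lambda>c. \<eta> (frame k x c # vs))"

lemma contract_bar_ext_mult:
  "contract_bar k x (a \<^bold>\<and> \<eta>) vs =
     wirtinger_bar (\<lambda>c. a (frame k x c)) * \<eta> vs - (a \<^bold>\<and> contract_bar k x \<eta>) vs"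
  by (simp add: contract_bar_def[abs_def] wirtinger_bar_def ext_mult_Cons)
     (simp add: ext_mult_def algebra_simps sum.distrib sum_distrib_left sum_divide_distrib
        add_divide_distrib)

lemma contract_bar_add_scale:
  "contract_bar k x (\<lambda>vs. \<eta> vs + c * \<theta> vs) vs = contract_bar k x \<eta> vs + c * contract_bar k x \<theta> vs"
  by (simp add: contract_bar_def wirtinger_bar_def field_simps)

lemma contract_bar_theta_wedge:
  "set I \<subseteq> {1, 2, 3} \<Longrightarrow> contract_bar k x (theta_wedge I x) vs = 0"
proof (induction I arbitrary: vs)
  case Nil
  show ?case by (simp add: contract_bar_def wedge_Nil wirtinger_bar_def)
next
  case (Cons j I)
  then have "wirtinger_bar (\<lambda>c. theta j x (frame k x c)) = 0"
    by (simp add: theta_frame wirtinger_bar_def)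
  moreover have "contract_bar k x (theta_wedge I x) = (\<lambda>vs. 0)" using Cons by auto
  ultimately show ?case by (simp add: wedge_Cons contract_bar_ext_mult ext_mult_zero)
qed

lemma contract_bar_Lam_p0:
  assumes "\<eta> \<in> Lam p 0 x"
  shows "contract_bar k x \<eta> = (\<lambda>vs. 0)"
proof
  fix vs
  have "\<eta> \<in> lin_span_c {theta_wedge I x | I. I \<in> multi_indices p}"
    using assms Lam_p0_subset_span_theta_wedge by blast
  then show "contract_bar k x \<eta> vs = 0"
  proof (induction \<eta> rule: lin_span_c_induct)
    case zero
    show ?case by (simp add: contract_bar_def wirtinger_bar_def)
  next
    case (add \<eta> c g)
    then show ?case
      by (auto simp: contract_bar_add_scale contract_bar_theta_wedge multi_indices_def)
  qed
qed

lemma sum_thetabar_ext_mult_eq_0_iff: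
  assumes "\<And>k. \<xi> k \<in> Lam p 0 x"
  shows "(\<lambda>vs. \<Sum>k\<in>{1, 2, 3}. (thetabar k x \<^bold>\<and> \<xi> k) vs) = (\<lambda>vs. 0) \<longleftrightarrow>
    (\<forall>k\<in>{1, 2, 3}. \<xi> k = (\<lambda>vs. 0))"
proof
  assume zero: "(\<lambda>vs. \<Sum>k\<in>{1, 2, 3}. (thetabar k x \<^bold>\<and> \<xi> k) vs) = (\<lambda>vs. 0)"
  show "\<forall>k\<in>{1, 2, 3}. \<xi> k = (\<lambda>vs. 0)"
  proof (intro ballI ext)
    fix m vs assume m: "m \<in> {1, 2, 3 :: nat}"
    have thetabar: "wirtinger_bar (\<lambda>c. thetabar k x (frame m x c)) = (if k = m then 1 else 0)"
      if "k \<in> {1, 2, 3}" for k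
      using that by (simp add: thetabar_def theta_frame wirtinger_bar_def)
    have "0 = contract_bar m x (\<lambda>vs. \<Sum>k\<in>{1, 2, 3}. (thetabar k x \<^bold>\<and> \<xi> k) vs) vs"
      by (simp only: zero) (simp add: contract_bar_def wirtinger_bar_def)
    also have "\<dots> = (\<Sum>k\<in>{1, 2, 3}. contract_bar m x (thetabar k x \<^bold>\<and> \<xi> k) vs)"
      by (simp add: contract_bar_def wirtinger_bar_def field_simps)
    also have "\<dots> = (\<Sum>k\<in>{1, 2, 3}. if k = m then \<xi> k vs else 0)"
      by (intro sum.cong refl)
         (simp only: contract_bar_ext_mult contract_bar_Lam_p0[OF assms] ext_mult_zero thetabar,
           simp)
    also have "\<dots> = \<xi> m vs" using m by (simp only: sum.delta finite.intros if_True)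
    finally show "\<xi> m vs = 0" ..
  qed
next
  assume "\<forall>k\<in>{1, 2, 3}. \<xi> k = (\<lambda>vs. 0)"
  then show "(\<lambda>vs. \<Sum>k\<in>{1, 2, 3}. (thetabar k x \<^bold>\<and> \<xi> k) vs) = (\<lambda>vs. 0)"
    by (simp add: ext_mult_zero)
qed

lemma has_dbar_imp_dbar_eq_0_iff:
  assumes "has_dbar p \<omega> x \<xi>"
  shows "dbar p 0 \<omega> x = (\<lambda>vs. 0) \<longleftrightarrow> (\<forall>k\<in>{1, 2, 3}. \<xi> k = (\<lambda>vs. 0))"
  unfolding has_dbar_imp_dbar_eq[OF assms]
  by (rule sum_thetabar_ext_mult_eq_0_iff) (rule has_dbarD[OF assms])

section \<open>Invariant functions on the group\<close>

text \<open>The line \<open>z \<mapsto> x + frame k x z\<close> is tangent to the \<open>k\<close>-th frame direction at each of its points,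
  and \<open>delbar_frame k\<close> restricts to the Cauchy-Riemann operator on it.\<close>

lemma frame_translate: "frame k (x + frame k x z) = frame k x"
  by (rule ext) (auto simp: frame_def tangent_def)

lemma has_derivative_along_frame:
  assumes "\<And>x. f differentiable (at x)"
  shows "((\<lambda>z. f (x + frame k x z)) has_derivative
    (\<lambda>c. frechet_derivative f (at (x + frame k x z)) (frame k x c))) (at z)"
proof -
  have "((\<lambda>z. x + frame k x z) has_derivative frame k x) (at z)"
    using has_derivative_add[OF has_derivative_const
        bounded_linear_imp_has_derivative[OF bounded_linear_frame]]
    by simp
  moreover have
    "(f has_derivative frechet_derivative f (at (x + frame k x z))) (at (x + frame k x z))"
    using assms by (simp only: frechet_derivative_works)
  ultimately show ?thesis by (rule has_derivative_compose)
qed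

lemma bounded_constant_delbar_frame:
  assumes diff: "\<And>x. f differentiable (at x)"
    and "bounded (range f)"
    and delbar: "\<And>x. delbar_frame k f x = c"
  shows "c = 0" and "f (x + frame k x z) = f x"
proof -
  define F where "F = (\<lambda>x z. f (x + frame k x z))"
  define F' where "F' = (\<lambda>x z c. frechet_derivative f (at (x + frame k x z)) (frame k x c))"
  have der: "(F x has_derivative F' x z) (at z)" for x z
    unfolding F_def F'_def by (rule has_derivative_along_frame[OF diff])
  have wirtinger_bar: "wirtinger_bar (F' x z) = c" for x z
    using delbar[of "x + frame k x z"] by (simp add: F'_def delbar_frame_def frame_translate)
  have bounded: "bounded (range (F x))" for x
    by (rule bounded_subset[OF assms(2)]) (auto simp: F_def)
  show "c = 0"
    by (rule bounded_constant_wirtinger_bar_eq_0[OF der[of 0] wirtinger_bar bounded])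
  have "F x z = F x 0"
    by (rule bounded_constant_wirtinger_bar_imp_constant[OF der wirtinger_bar bounded])
  then show "f (x + frame k x z) = f x"
    by (simp add: F_def linear_0[OF bounded_linear.linear[OF bounded_linear_frame]])
qed

text \<open>Every point is reached from the origin by moving along the three frame directions in turn.\<close>

lemma bounded_delbar_frame_eq_0_imp_constant:
  assumes "\<And>x. f differentiable (at x)" "bounded (range f)"
    and "\<And>k x. k \<in> {1, 2, 3} \<Longrightarrow> delbar_frame k f x = 0"
  shows "f x = f 0"
proof -
  have move: "f (y + frame k y z) = f y" if "k \<in> {1, 2, 3}" for k y z
    using bounded_constant_delbar_frame(2)[OF assms(1,2) assms(3)[OF that]] .
  obtain a b c where x: "x = (a, b, c)" by (cases x)
  define y where "y = 0 + frame 3 0 b"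
  define w where "w = y + frame 1 y (cnj a + c)"
  have "x = w + frame 2 w (a - cnj c)"
    by (simp add: x w_def y_def frame_coordinates[simplified] field_simps)
  then have "f x = f w" by (simp add: move)
  also have "\<dots> = f y" unfolding w_def by (simp add: move)
  also have "\<dots> = f 0" unfolding y_def by (rule move) simp
  finally show ?thesis .
qed

lemma bounded_delbar_frame_step:
  assumes "\<And>x. g differentiable (at x)" "bounded (range g)"
    and g: "\<And>k x. k \<in> {1, 2, 3} \<Longrightarrow> delbar_frame k g x = (if k = m then a * h x else 0)"
    and h: "\<And>x. h x = h 0"
    and "m \<in> {1, 2, 3}" "a \<noteq> 0"
  shows "h x = 0" and "g x = g 0"
proof -
  have "delbar_frame m g x = a * h 0" for x
    using g[OF assms(5), of x] h[of x] by simp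
  from bounded_constant_delbar_frame(1)[OF assms(1,2) this] have "a * h 0 = 0" .
  then show h0: "h x = 0" for x using \<open>a \<noteq> 0\<close> h[of x] by simp
  show "g x = g 0"
    by (rule bounded_delbar_frame_eq_0_imp_constant[OF assms(1,2)]) (simp add: g h0)
qed

lemma bounded_delbar_frame_chain:
  assumes "\<And>u x. u \<in> {f, g, h} \<Longrightarrow> u differentiable (at x)"
    and "\<And>u. u \<in> {f, g, h} \<Longrightarrow> bounded (range u)"
    and f: "\<And>k x. k \<in> {1, 2, 3} \<Longrightarrow> delbar_frame k f x = 0"
    and g: "\<And>k x. k \<in> {1, 2, 3} \<Longrightarrow> delbar_frame k g x = (if k = m then a * f x else 0)"
    and h: "\<And>k x. k \<in> {1, 2, 3} \<Longrightarrow> delbar_frame k h x = (if k = n then b * g x else 0)"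
    and "m \<in> {1, 2, 3}" "a \<noteq> 0" "n \<in> {1, 2, 3}" "b \<noteq> 0"
  shows "f x = 0" and "g x = 0" and "h x = h 0"
proof -
  have f_const: "f x = f 0" for x
    by (rule bounded_delbar_frame_eq_0_imp_constant[OF _ _ f]) (simp_all add: assms)
  show "f x = 0"
    by (rule bounded_delbar_frame_step(1)[OF _ _ g f_const assms(6,7)]) (simp_all add: assms)
  have g_const: "g x = g 0" for x
    by (rule bounded_delbar_frame_step(2)[OF _ _ g f_const assms(6,7)]) (simp_all add: assms)
  show "g x = 0"
    by (rule bounded_delbar_frame_step(1)[OF _ _ h g_const assms(8,9)]) (simp_all add: assms)
  show "h x = h 0"
    by (rule bounded_delbar_frame_step(2)[OF _ _ h g_const assms(8,9)]) (simp_all add: assms)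
qed

lemma gaussian_int_approx:
  obtains m where "gaussian_int m" "norm (z - m) \<le> 2"
proof
  define m where "m = Complex \<lfloor>Re z\<rfloor> \<lfloor>Im z\<rfloor>"
  show "gaussian_int m" by (simp add: m_def gaussian_int_def)
  have "norm (z - m) \<le> \<bar>Re z - \<lfloor>Re z\<rfloor>\<bar> + \<bar>Im z - \<lfloor>Im z\<rfloor>\<bar>"
    using cmod_le[of "z - m"] by (simp add: m_def)
  then show "norm (z - m) \<le> 2" by linarith
qed

lemma Gamma_reduce:
  obtains \<gamma> y where "\<gamma> \<in> Gamma" "y \<in> cball 0 2 \<times> cball 0 2 \<times> cball 0 2" "x = Hmul \<gamma> y"
proof -
  obtain a b c where x: "x = (a, b, c)" by (cases x)
  obtain m where m: "gaussian_int m" "norm (a - m) \<le> 2" by (rule gaussian_int_approx)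
  obtain n where n: "gaussian_int n" "norm (b - n) \<le> 2" by (rule gaussian_int_approx)
  obtain r where r: "gaussian_int r" "norm (c - m * (b - n) - r) \<le> 2" by (rule gaussian_int_approx)
  show thesis
  proof
    show "(m, n, r) \<in> Gamma" using m n r by (simp add: Gamma_def)
    show "(a - m, b - n, c - m * (b - n) - r) \<in> cball 0 2 \<times> cball 0 2 \<times> cball 0 2"
      using m n r by simp
    show "x = Hmul (m, n, r) (a - m, b - n, c - m * (b - n) - r)" by (simp add: Hmul_def x)
  qed
qed

lemma Gamma_invariant_bounded:
  fixes f :: "pt \<Rightarrow> 'a::metric_space"
  assumes "continuous_on UNIV f" "\<And>\<gamma> x. \<gamma> \<in> Gamma \<Longrightarrow> f (Hmul \<gamma> x) = f x"
  shows "bounded (range f)"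
proof -
  let ?K = "cball 0 2 \<times> cball 0 2 \<times> cball 0 2 :: pt set"
  have "compact ?K" by (intro compact_Times compact_cball)
  then have "bounded (f ` ?K)"
    using assms(1)
    by (intro compact_imp_bounded compact_continuous_image) (auto intro: continuous_on_subset)
  moreover have "range f \<subseteq> f ` ?K"
  proof (rule image_subsetI)
    fix x
    obtain \<gamma> y where "\<gamma> \<in> Gamma" "y \<in> ?K" "x = Hmul \<gamma> y" by (rule Gamma_reduce)
    then show "f x \<in> f ` ?K" using assms(2) by auto
  qed
  ultimately show ?thesis by (rule bounded_subset)
qed

section \<open>Forms on the Iwasawa manifold\<close>

lemma ApqD:
  assumes "\<psi> \<in> Apq p q"
  shows "(\<lambda>x. \<psi> x vs) differentiable (at x)" "\<psi> x \<in> Lam p q x"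
    "\<gamma> \<in> Gamma \<Longrightarrow> pullback (Hmul \<gamma>) \<psi> = \<psi>"
  using assms Cinf_differentiable unfolding Apq_def by blast+

lemma frechet_derivative_Hmul:
  "frechet_derivative (Hmul \<gamma>) (at x) v = (fst v, fst (snd v), snd (snd v) + fst \<gamma> * fst (snd v))"
proof -
  have "(Hmul \<gamma> has_derivative
      (\<lambda>v. (fst v, fst (snd v), snd (snd v) + fst \<gamma> * fst (snd v)))) (at x)"
    unfolding Hmul_def[abs_def] by (rule has_derivative_eq_rhs, (rule derivative_intros)+) auto
  from frechet_derivative_at[OF this, symmetric] show ?thesis by simp
qed

lemma theta_Hmul: "theta j (Hmul \<gamma> x) (frechet_derivative (Hmul \<gamma>) (at x) v) = theta j x v"
  by (simp add: theta_coordinates frechet_derivative_Hmul Hmul_def algebra_simps)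

lemma frame_Hmul: "frame k (Hmul \<gamma> x) c = frechet_derivative (Hmul \<gamma>) (at x) (frame k x c)"
  by (simp add: frechet_derivative_Hmul frame_def tangent_def Hmul_def algebra_simps)

lemma pullback_theta_wedge: "pullback (Hmul \<gamma>) (theta_wedge I) = theta_wedge I"
proof (intro ext)
  fix x vs
  have "theta_wedge I (Hmul \<gamma> x) (map (frechet_derivative (Hmul \<gamma>) (at x)) vs) = theta_wedge I x vs"
    unfolding wedge_def
    by (auto intro!: sum.cong prod.cong
        simp: theta_Hmul permutes_in_image[of _ "{..<_}", simplified])
  then show "pullback (Hmul \<gamma>) (theta_wedge I) x vs = theta_wedge I x vs"
    by (simp add: pullback_def)
qed

lemma Cinf_theta: "Cinf (\<lambda>x. theta j x v)"
proof -
  have fst: "Cinf (\<lambda>x::pt. fst x)"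
    by (rule Cinf_linear[OF bounded_linear_fst])
  have cnj_fst: "Cinf (\<lambda>x::pt. cnj (fst x))"
    by (rule Cinf_linear[OF bounded_linear_compose[OF bounded_linear_cnj bounded_linear_fst]])
  have "Cinf (\<lambda>x::pt. (cnj (fst v) + snd (snd v)) + - fst (snd v) * fst x)"
    by (intro Cinf_add Cinf_mult Cinf_const fst)
  moreover have "Cinf (\<lambda>x::pt. (fst v - cnj (snd (snd v))) + cnj (fst (snd v)) * cnj (fst x))"
    by (intro Cinf_add Cinf_mult Cinf_const cnj_fst)
  ultimately show ?thesis
    by (cases "j = 1"; cases "j = 2") (simp_all add: theta_coordinates Cinf_const algebra_simps)
qed

lemma Cinf_theta_wedge: "Cinf (\<lambda>x. theta_wedge I x vs)"
proof (induction I arbitrary: vs)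
  case Nil
  show ?case by (simp add: Cinf_const)
qed (simp add: wedge_Cons Cinf_ext_mult Cinf_theta)

lemma theta_wedge_Apq: "(\<lambda>x vs. c * theta_wedge I x vs) \<in> Apq (length I) 0"
  unfolding Apq_def
proof (intro CollectI conjI allI ballI)
  show "Cinf (\<lambda>x. c * theta_wedge I x vs)" for vs
    by (intro Cinf_mult Cinf_const Cinf_theta_wedge)
  show "(\<lambda>vs. c * theta_wedge I x vs) \<in> Lam (length I) 0 x" for x
    using theta_wedge_Lam unfolding Lam_def by (intro lin_span_c_scale)
  have "pullback (Hmul \<gamma>) (\<lambda>x vs. c * theta_wedge I x vs) =
      (\<lambda>x vs. c * pullback (Hmul \<gamma>) (theta_wedge I) x vs)" for \<gamma>
    by (intro ext) (simp only: pullback_def)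
  then show "pullback (Hmul \<gamma>) (\<lambda>x vs. c * theta_wedge I x vs) =
      (\<lambda>x vs. c * theta_wedge I x vs)" for \<gamma>
    by (simp only: pullback_theta_wedge)
qed

definition frame_coeff :: "cform \<Rightarrow> nat list \<Rightarrow> pt \<Rightarrow> complex" where
  "frame_coeff \<psi> I x = \<psi> x (frame_tuple I x)"

lemma Lam_multilinear:
  assumes "\<eta> \<in> Lam p q x"
  shows "multilinear \<eta>"
  using assms unfolding Lam_def
proof (induction \<eta> rule: lin_span_c_induct)
  case zero
  show ?case by (simp add: multilinear_def linear_iff)
next
  case (add \<eta> c g)
  have "linear (phibar j x)" for j
    using linear_compose[OF linear_phi bounded_linear.linear[OF bounded_linear_cnj]]
    by (simp add: phibar_def[abs_def] o_def)
  then have "multilinear g"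
    using add.hyps(2) by (auto simp: gens_def intro!: multilinear_wedge intro: linear_phi)
  then show ?case by (intro multilinear_add_scale add.IH)
qed

lemma frame_coeff_differentiable:
  assumes "\<psi> \<in> Apq p q"
  shows "frame_coeff \<psi> I differentiable (at x)"
proof -
  have frame_differentiable: "(\<lambda>x. frame k x 1) differentiable (at x)" for k
  proof -
    have "(\<lambda>x::pt. fst x * c) differentiable (at x)" for c
      by (intro differentiable_mult bounded_linear_imp_differentiable bounded_linear_fst
          differentiable_const)
    then show ?thesis unfolding frame_def tangent_def
      by (intro differentiable_Pair differentiable_const differentiable_add)
  qed
  note apply_differentiable =
    differentiable_multilinear_apply[OF Lam_multilinear[OF ApqD(2)[OF assms]] ApqD(1)[OF assms]]
  have "(\<lambda>x. \<psi> x ([] @ frame_tuple I x)) differentiable (at x)"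
    by (intro apply_differentiable frame_differentiable)
  then show ?thesis by (simp add: frame_coeff_def[abs_def])
qed

lemma frame_coeff_bounded:
  assumes "\<psi> \<in> Apq p q"
  shows "bounded (range (frame_coeff \<psi> I))"
proof (rule Gamma_invariant_bounded)
  show "continuous_on UNIV (frame_coeff \<psi> I)"
    using frame_coeff_differentiable[OF assms]
    by (simp add: continuous_on_eq_continuous_at differentiable_imp_continuous_within)
  fix \<gamma> x assume "\<gamma> \<in> Gamma"
  then have "pullback (Hmul \<gamma>) \<psi> x (frame_tuple I x) = \<psi> x (frame_tuple I x)"
    by (simp only: ApqD(3)[OF assms])
  then show "frame_coeff \<psi> I (Hmul \<gamma> x) = frame_coeff \<psi> I x"
    by (simp add: frame_coeff_def pullback_def frame_Hmul o_def)
qed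

lemma Apq_p0_expand:
  assumes "\<psi> \<in> Apq p 0"
  shows "\<psi> = (\<lambda>x vs. \<Sum>I\<in>multi_indices p. frame_coeff \<psi> I x * theta_wedge I x vs)"
  unfolding frame_coeff_def by (rule ext, rule Lam_p0_expand[OF ApqD(2)[OF assms]])

lemma Apq_p0_has_dbar:
  assumes "\<psi> \<in> Apq p 0"
  shows "has_dbar p \<psi> x (\<lambda>k vs. \<Sum>I\<in>multi_indices p.
    delbar_frame k (frame_coeff \<psi> I) x * theta_wedge I x vs +
    frame_coeff \<psi> I x * dbar_theta_wedge k I x vs)"
    (is "has_dbar p \<psi> x (\<lambda>k vs. \<Sum>I\<in>multi_indices p. ?\<xi> I k vs)")
proof -
  have "has_dbar p (\<lambda>y vs. frame_coeff \<psi> I y * theta_wedge I y vs) x (?\<xi> I)"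
    if "I \<in> multi_indices p" for I
    using has_dbar_mult[OF frame_coeff_differentiable[OF assms] has_dbar_theta_wedge[of I x]] that
    by (simp add: multi_indices_def)
  then have "has_dbar p (\<lambda>y vs. \<Sum>I\<in>multi_indices p. frame_coeff \<psi> I y * theta_wedge I y vs) x
      (\<lambda>k vs. \<Sum>I\<in>multi_indices p. ?\<xi> I k vs)"
    by (rule has_dbar_sum)
  then show ?thesis by (simp only: Apq_p0_expand[OF assms, symmetric])
qed

lemma dbar_closed_p0_delbar_frame:
  assumes "\<psi> \<in> dbar_closed_p0 p" "k \<in> {1, 2, 3}" "J \<in> multi_indices p"
  shows "delbar_frame k (frame_coeff \<psi> J) x =
    - (\<Sum>I\<in>multi_indices p. frame_coeff \<psi> I x * dbar_theta_wedge k I x (frame_tuple J x))"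
proof -
  have "\<psi> \<in> Apq p 0" "dbar p 0 \<psi> x = (\<lambda>vs. 0)" using assms(1) by (auto simp: dbar_closed_p0_def)
  then have "(\<lambda>vs. \<Sum>I\<in>multi_indices p. delbar_frame k (frame_coeff \<psi> I) x * theta_wedge I x vs +
      frame_coeff \<psi> I x * dbar_theta_wedge k I x vs) = (\<lambda>vs. 0)"
    using has_dbar_imp_dbar_eq_0_iff[OF Apq_p0_has_dbar] assms(2) by blast
  from fun_cong[OF this, of "frame_tuple J x"]
  have "(\<Sum>I\<in>multi_indices p. delbar_frame k (frame_coeff \<psi> I) x * (if I = J then 1 else 0)) +
      (\<Sum>I\<in>multi_indices p. frame_coeff \<psi> I x * dbar_theta_wedge k I x (frame_tuple J x)) = 0"
    using assms(3) by (simp add: sum.distrib theta_wedge_frame_tuple cong: sum.cong)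
  moreover have "(\<Sum>I\<in>multi_indices p.
        delbar_frame k (frame_coeff \<psi> I) x * (if I = J then 1 else 0)) =
      delbar_frame k (frame_coeff \<psi> J) x"
    using assms(3) by (simp add: finite_multi_indices if_distrib[of "\<lambda>t. _ * t"] cong: if_cong)
  ultimately show ?thesis by (simp add: eq_neg_iff_add_eq_0)
qed

lemma cline_theta_wedge_subset_dbar_closed:
  assumes "\<And>k x. dbar_theta_wedge k I x = (\<lambda>vs. 0)"
  shows "cline (theta_wedge I) \<subseteq> dbar_closed_p0 (length I)"
proof
  fix \<psi> assume "\<psi> \<in> cline (theta_wedge I)"
  then obtain c where \<psi>: "\<psi> = (\<lambda>x vs. c * theta_wedge I x vs)" by (auto simp: cline_def)
  have "has_dbar (length I) \<psi> x
      (\<lambda>k vs. delbar_frame k (\<lambda>x. c) x * theta_wedge I x vs + c * dbar_theta_wedge k I x vs)" for x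
    unfolding \<psi> by (rule has_dbar_mult[OF differentiable_const has_dbar_theta_wedge])
  from has_dbar_imp_dbar_eq_0_iff[OF this] have "dbar (length I) 0 \<psi> x = (\<lambda>vs. 0)" for x
    by (simp add: assms delbar_frame_def wirtinger_bar_def)
  then show "\<psi> \<in> dbar_closed_p0 (length I)"
    using theta_wedge_Apq[of c I] by (auto simp: dbar_closed_p0_def \<psi>)
qed

lemma mem_cline_theta_wedgeI:
  assumes "\<psi> \<in> Apq p 0" "J \<in> multi_indices p"
    and "\<And>I x. I \<in> multi_indices p \<Longrightarrow> I \<noteq> J \<Longrightarrow> frame_coeff \<psi> I x = 0"
    and "\<And>x. frame_coeff \<psi> J x = c"
  shows "\<psi> \<in> cline (theta_wedge J)"
proof -
  have "(\<Sum>I\<in>multi_indices p. frame_coeff \<psi> I x * theta_wedge I x vs) =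
      (\<Sum>I\<in>multi_indices p. if I = J then c * theta_wedge J x vs else 0)" for x vs
    using assms(3,4) by (intro sum.cong refl) auto
  then have "\<psi> = (\<lambda>x vs. c * theta_wedge J x vs)"
    using Apq_p0_expand[OF assms(1)] assms(2) by (simp add: finite_multi_indices)
  then show ?thesis by (auto simp: cline_def)
qed

lemma dbar_closed_p0_eq_cline_if_chain:
  assumes indices: "multi_indices p = {I, J, K}" and "distinct [I, J, K]"
    and I: "\<And>k x. dbar_theta_wedge k I x = (\<lambda>vs. if k = m then a * theta_wedge J x vs else 0)"
    and J: "\<And>k x. dbar_theta_wedge k J x = (\<lambda>vs. if k = n then b * theta_wedge K x vs else 0)"
    and K: "\<And>k x. dbar_theta_wedge k K x = (\<lambda>vs. 0)"
    and "m \<in> {1, 2, 3}" "a \<noteq> 0" "n \<in> {1, 2, 3}" "b \<noteq> 0"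
  shows "dbar_closed_p0 p = cline (theta_wedge K)"
proof
  have "K \<in> multi_indices p" by (simp add: indices)
  then have "length K = p" by (simp add: multi_indices_def)
  then show "cline (theta_wedge K) \<subseteq> dbar_closed_p0 p"
    using cline_theta_wedge_subset_dbar_closed[OF K] by simp
  show "dbar_closed_p0 p \<subseteq> cline (theta_wedge K)"
  proof
    fix \<psi> assume closed: "\<psi> \<in> dbar_closed_p0 p"
    then have \<psi>: "\<psi> \<in> Apq p 0" by (simp add: dbar_closed_p0_def)
    let ?f = "frame_coeff \<psi>"
    have dual: "theta_wedge L x (frame_tuple M x) = (if L = M then 1 else 0)"
      if "L \<in> {I, J, K}" "M \<in> {I, J, K}" for L M x
      using that by (intro theta_wedge_frame_tuple[of _ p]) (simp_all only: indices)
    have delbar_I: "delbar_frame k (?f I) x = 0"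
      and delbar_J: "delbar_frame k (?f J) x = (if k = m then - a * ?f I x else 0)"
      and delbar_K: "delbar_frame k (?f K) x = (if k = n then - b * ?f J x else 0)"
      if "k \<in> {1, 2, 3}" for k x
      using that \<open>distinct [I, J, K]\<close>
      by (auto simp: dbar_closed_p0_delbar_frame[OF closed] indices I J K dual)
    have "?f I x = 0" "?f J x = 0" "?f K x = ?f K 0" for x
      by (rule bounded_delbar_frame_chain[OF _ _ delbar_I delbar_J delbar_K];
          use assms in \<open>auto intro: frame_coeff_differentiable[OF \<psi>] frame_coeff_bounded[OF \<psi>]\<close>)+
    then show "\<psi> \<in> cline (theta_wedge K)"
      using \<open>K \<in> multi_indices p\<close> by (intro mem_cline_theta_wedgeI[OF \<psi>]) (auto simp: indices)
  qed
qed

lemma multi_indices_1: "multi_indices 1 = {[2], [1], [3]}"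
  and multi_indices_2: "multi_indices 2 = {[1, 2], [2, 3], [1, 3]}"
  and multi_indices_3: "multi_indices 3 = {[1, 2, 3]}"
  by (auto simp: multi_indices_def numeral_eq_Suc length_Suc_conv)

lemma dbar_theta_wedge_degree_1:
  "dbar_theta_wedge k [2] x = (\<lambda>vs. if k = 3 then (- 1 / 2) * theta_wedge [1] x vs else 0)"
  "dbar_theta_wedge k [1] x = (\<lambda>vs. if k = 1 then (- 1 / 2) * theta_wedge [3] x vs else 0)"
  "dbar_theta_wedge k [3] x = (\<lambda>vs. 0)"
  by (auto simp: wedge_Cons dbar_theta_ext_mult ext_mult_linear)

lemma dbar_theta_wedge_degree_2:
  "dbar_theta_wedge k [1, 2] x = (\<lambda>vs. if k = 1 then 1 / 2 * theta_wedge [2, 3] x vs else 0)"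
  "dbar_theta_wedge k [2, 3] x = (\<lambda>vs. if k = 3 then (- 1 / 2) * theta_wedge [1, 3] x vs else 0)"
  "dbar_theta_wedge k [1, 3] x = (\<lambda>vs. 0)"
  by (auto simp: wedge_Cons dbar_theta_ext_mult ext_mult_linear ext_mult_self
      ext_mult_anticommute[of "theta 3 x" "theta 2 x"])

lemma dbar_theta_wedge_degree_3: "dbar_theta_wedge k [1, 2, 3] x = (\<lambda>vs. 0)"
  by (auto simp: wedge_Cons dbar_theta_ext_mult ext_mult_linear[abs_def] ext_mult_self[abs_def]
      ext_mult_anticommute[of "theta 3 x" "theta 2 x"])

lemma dbar_closed_1_0: "dbar_closed_p0 1 = cline (theta_wedge [3])"
  by (rule dbar_closed_p0_eq_cline_if_chain[OF multi_indices_1 _ dbar_theta_wedge_degree_1])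
     simp_all

lemma dbar_closed_2_0: "dbar_closed_p0 2 = cline (theta_wedge [1, 3])"
  by (rule dbar_closed_p0_eq_cline_if_chain[OF multi_indices_2 _ dbar_theta_wedge_degree_2])
     simp_all

lemma dbar_closed_3_0: "dbar_closed_p0 3 = cline (theta_wedge [1, 2, 3])"
proof
  show "cline (theta_wedge [1, 2, 3]) \<subseteq> dbar_closed_p0 3"
    using cline_theta_wedge_subset_dbar_closed[OF dbar_theta_wedge_degree_3]
    by (simp add: numeral_3_eq_3)
  show "dbar_closed_p0 3 \<subseteq> cline (theta_wedge [1, 2, 3])"
  proof
    fix \<psi> assume closed: "\<psi> \<in> dbar_closed_p0 3"
    then have \<psi>: "\<psi> \<in> Apq 3 0" by (simp add: dbar_closed_p0_def)
    have "delbar_frame k (frame_coeff \<psi> [1, 2, 3]) x = 0" if "k \<in> {1, 2, 3}" for k x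
      using dbar_closed_p0_delbar_frame[OF closed that, of "[1, 2, 3]"]
      by (simp add: multi_indices_3 dbar_theta_wedge_degree_3
          del: dbar_theta_wedge.simps One_nat_def)
    then have "frame_coeff \<psi> [1, 2, 3] x = frame_coeff \<psi> [1, 2, 3] 0" for x
      by (rule bounded_delbar_frame_eq_0_imp_constant[OF frame_coeff_differentiable[OF \<psi>]
            frame_coeff_bounded[OF \<psi>]])
    then show "\<psi> \<in> cline (theta_wedge [1, 2, 3])"
      by (intro mem_cline_theta_wedgeI[OF \<psi>]) (auto simp: multi_indices_3)
  qed
qed

lemma phi_3_eq_theta_wedge: "(\<lambda>x. wedge [phi 3 x]) = (\<lambda>x vs. 1 * theta_wedge [3] x vs)"
  by (simp add: phi_eq_theta)

lemma phi_13_23_eq_theta_wedge: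
  "(\<lambda>x vs. \<i> * wedge [phi 1 x, phi 3 x] vs + wedge [phi 2 x, phi 3 x] vs) =
   (\<lambda>x vs. \<i> * theta_wedge [1, 3] x vs)"
  by (simp add: wedge_Cons phi_ext_mult field_simps)

lemma phi_123_eq_theta_wedge:
  "(\<lambda>x. wedge [phi 1 x, phi 2 x, phi 3 x]) = (\<lambda>x vs. (- \<i> / 2) * theta_wedge [1, 2, 3] x vs)"
  by (simp add: wedge_Cons phi_ext_mult ext_mult_linear[abs_def] ext_mult_self
      ext_mult_anticommute[of "theta 2 x" "theta (Suc 0) x" for x] field_simps)

lemma scaled_theta_wedge_neq_0:
  assumes "I \<in> multi_indices p" "c \<noteq> 0"
  shows "(\<lambda>x vs. c * theta_wedge I x vs) \<noteq> (\<lambda>x vs. 0)"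
proof
  assume "(\<lambda>x vs. c * theta_wedge I x vs) = (\<lambda>x vs. 0)"
  then have "c * theta_wedge I 0 (frame_tuple I 0) = 0" by meson
  then show False using assms by (simp add: theta_wedge_frame_tuple)
qed

lemma cline_scale:
  assumes "c \<noteq> 0"
  shows "cline (\<lambda>x vs. c * \<psi> x vs) = cline \<psi>"
proof
  show "cline (\<lambda>x vs. c * \<psi> x vs) \<subseteq> cline \<psi>"
    by (auto simp: cline_def simp flip: mult.assoc)
  show "cline \<psi> \<subseteq> cline (\<lambda>x vs. c * \<psi> x vs)"
  proof
    fix \<theta> assume "\<theta> \<in> cline \<psi>"
    then obtain d where "\<theta> = (\<lambda>x vs. d * \<psi> x vs)" by (auto simp: cline_def)
    then have "\<theta> = (\<lambda>x vs. (d / c) * (c * \<psi> x vs))" using assms by simp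
    then show "\<theta> \<in> cline (\<lambda>x vs. c * \<psi> x vs)" unfolding cline_def by blast
  qed
qed

theorem mainTheorem9:
  shows "(\<lambda>x. wedge [phi 3 x]) \<noteq> (\<lambda>x vs. 0)
       \<and> dbar_closed_p0 1 = cline (\<lambda>x. wedge [phi 3 x])
       \<and> (\<lambda>x vs. \<i> * wedge [phi 1 x, phi 3 x] vs + wedge [phi 2 x, phi 3 x] vs) \<noteq> (\<lambda>x vs. 0)
       \<and> dbar_closed_p0 2 = cline (\<lambda>x vs. \<i> * wedge [phi 1 x, phi 3 x] vs + wedge [phi 2 x, phi 3 x] vs)
       \<and> (\<lambda>x. wedge [phi 1 x, phi 2 x, phi 3 x]) \<noteq> (\<lambda>x vs. 0)
       \<and> dbar_closed_p0 3 = cline (\<lambda>x. wedge [phi 1 x, phi 2 x, phi 3 x])"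
  unfolding phi_3_eq_theta_wedge phi_13_23_eq_theta_wedge phi_123_eq_theta_wedge
proof (intro conjI)
  show "(\<lambda>x vs. 1 * theta_wedge [3] x vs) \<noteq> (\<lambda>x vs. 0)"
    by (rule scaled_theta_wedge_neq_0[of _ 1]) (simp_all add: multi_indices_1 del: One_nat_def)
  show "(\<lambda>x vs. \<i> * theta_wedge [1, 3] x vs) \<noteq> (\<lambda>x vs. 0)"
    by (rule scaled_theta_wedge_neq_0[of _ 2]) (simp_all add: multi_indices_2)
  show "(\<lambda>x vs. (- \<i> / 2) * theta_wedge [1, 2, 3] x vs) \<noteq> (\<lambda>x vs. 0)"
    by (rule scaled_theta_wedge_neq_0[of _ 3]) (simp_all add: multi_indices_3)
  show "dbar_closed_p0 1 = cline (\<lambda>x vs. 1 * theta_wedge [3] x vs)"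
    by (subst cline_scale) (simp_all only: dbar_closed_1_0 one_neq_zero not_False_eq_True)
  show "dbar_closed_p0 2 = cline (\<lambda>x vs. \<i> * theta_wedge [1, 3] x vs)"
    by (subst cline_scale) (simp_all add: dbar_closed_2_0)
  show "dbar_closed_p0 3 = cline (\<lambda>x vs. (- \<i> / 2) * theta_wedge [1, 2, 3] x vs)"
    by (subst cline_scale) (simp_all add: dbar_closed_3_0)
qed

end
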